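(* Let $k,m,n$ be positive integers with $m\le n$, let $\mathscr{S}:\mathbb{R}^k\to\mathbb{R}^{m\times n}$ be an affine map, let $\mathcal{U}=\{u\in\mathbb{R}^k:\operatorname{rank}\mathscr{S}(u)<m\}$, and let $\bar\theta\in\mathcal{U}$. Let $\mathcal{M}_{\rm def}=\{A\in\mathbb{R}^{m\times n}:\operatorname{rank}A=m-1\}$ and $\mathcal{L}=\operatorname{Im}\mathscr{S}$, and assume that $\mathcal{M}_{\rm def}$ and the affine space $\mathcal{L}$ meet non-tangentially at the point $\mathscr{S}(\bar\theta)$. Then there exists $\varepsilon>0$ such that for every $\theta\in\mathbb{R}^k$ with $\|\theta-\bar\theta\|<\varepsilon$, the SDP relaxation $(\mathrm{SDP}_\theta)$, $(\mathrm{SDP}^*_\theta)$ defined in the context is exact, and so recovers the global minimizer of the problem $$\min_{u\in\mathcal{U}}\ \|u-\theta\|^2 .$$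
   Context: Norms on $\mathbb{R}^k$ are Euclidean. Non-tangentiality: two manifolds $\mathcal{M}_1,\mathcal{M}_2$ in a Euclidean space meet non-tangentially at a point $p\in\mathcal{M}_1\cap\mathcal{M}_2$ if $\mathcal{M}_1\cap\mathcal{M}_2$ is a (smooth) manifold near $p$ and $T_p(\mathcal{M}_1\cap\mathcal{M}_2)=T_p(\mathcal{M}_1)\cap T_p(\mathcal{M}_2)$, where $T_p$ denotes the tangent space at $p$. Let $N=(k+1)m$, and let $\mathbb{S}^N$ be the space of real symmetric $N\times N$ matrices with inner product $C\bullet X=\operatorname{tr}(CX)$. A matrix $X\in\mathbb{S}^N$ is $m$-block symmetric if, when divided into $m\times m$ blocks, all $(k+1)^2$ blocks are symmetric matrices; $\mathcal{BS}^N_m\subseteq\mathbb{S}^N$ is the space of such matrices, and $(\mathcal{BS}^N_m)^\perp$ is its orthogonal complement in $\mathbb{S}^N$. For $M\in\mathbb{R}^{N\times N}$, $\mathrm{bSym}(M)\in\mathcal{BS}^N_m$ is obtained by first forming $\frac12(M+M^T)$ and then replacing each of its $m\times m$ blocks $B$ by $\frac12(B+B^T)$. For $\theta\in\mathbb{R}^k$ write $\mathscr{S}(v+\theta)=A_\theta+\sum_{j=1}^k v_jB_j$ with $A_\theta,B_1,\dots,B_k\in\mathbb{R}^{m\times n}$, and let $s^\theta_1,\dots,s^\theta_n\in\mathbb{R}^N$ be the columns of the vertical concatenation of $A_\theta,B_1,\dots,B_k$ (an $N\times n$ matrix). Let $e_1,\dots,e_N$ be the canonical basis of $\mathbb{R}^N$.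 Write $X\in\mathbb{S}^N$ as $X=\begin{pmatrix} X_{zz} & X_{zy} \\ X_{zy}^T & X_{yy} \end{pmatrix}$ with $X_{zz}$ of size $m\times m$ and $X_{yy}$ of size $mk\times mk$. The primal SDP is $$(\mathrm{SDP}_\theta)\quad \min_{X}\ \operatorname{tr}(X_{yy})\ \text{ s.t. }\ \operatorname{tr}(X_{zz})=1,\ \ \mathrm{bSym}(s^\theta_ie_j^T)\bullet X=0\ \ (1\le i\le n,\ 1\le j\le N),\ \ X\in\mathcal{BS}^N_m,\ \ X\succeq0,$$ and the dual SDP is $$(\mathrm{SDP}^*_\theta)\quad \max_{\gamma,\mu,\Sigma}\ \gamma\ \text{ s.t. }\ \begin{pmatrix} -\gamma I_m & 0 \\ 0 & I_{mk} \end{pmatrix}-\sum_{i,j}\mu_{ij}\,\mathrm{bSym}(s^\theta_ie_j^T)-\Sigma\succeq0,\quad \gamma,\mu_{ij}\in\mathbb{R},\ \Sigma\in(\mathcal{BS}^N_m)^\perp .$$ The relaxation is exact at $\theta$ if the optimal values of $\min_{u\in\mathcal U}\|u-\theta\|^2$, $(\mathrm{SDP}_\theta)$ and $(\mathrm{SDP}^*_\theta)$ coincide and $(\mathrm{SDP}_\theta)$ has a unique minimizer $X^*$, which has rank one. Then $X^*=x^*(x^* )^T$ with $x^*=\begin{pmatrix} 1 \\ v^* \end{pmatrix}\otimes z^*$ for some unit vector $z^*\in\mathbb{R}^m$ and some $v^*\in\mathbb{R}^k$, and the recovered global minimizer is $u^*=\theta+v^*$. *)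

theory Defs
  imports "HOL-Analysis.Analysis"
begin

section \<open>Smooth maps, embedded submanifolds, non-tangential intersection\<close>

text \<open>On an open set of a Euclidean space, \<open>f\<close> is of class \<open>C\<^sup>r\<^sup>+\<^sup>1\<close> iff it is differentiable and all its
  directional derivatives are of class \<open>C\<^sup>r\<close>. The predicates are only used on open sets.\<close>

primrec Ck_on :: "nat \<Rightarrow> 'a::euclidean_space set \<Rightarrow> ('a \<Rightarrow> 'b::real_normed_vector) \<Rightarrow> bool" where
  "Ck_on 0 U f \<longleftrightarrow> continuous_on U f"
| "Ck_on (Suc r) U f \<longleftrightarrow>
     (\<forall>x\<in>U. f differentiable (at x)) \<and> (\<forall>v. Ck_on r U (\<lambda>x. frechet_derivative f (at x) v))"

definition smooth_on :: "'a::euclidean_space set \<Rightarrow> ('a \<Rightarrow> 'b::real_normed_vector) \<Rightarrow> bool" where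
  "smooth_on U f \<longleftrightarrow> (\<forall>r. Ck_on r U f)"

definition diffeomorphism ::
    "'a::euclidean_space set \<Rightarrow> 'a set \<Rightarrow> ('a \<Rightarrow> 'a) \<Rightarrow> ('a \<Rightarrow> 'a) \<Rightarrow> bool" where
  "diffeomorphism W W' \<phi> \<psi> \<longleftrightarrow>
     open W \<and> open W' \<and> homeomorphism W W' \<phi> \<psi> \<and> smooth_on W \<phi> \<and> smooth_on W' \<psi>"

text \<open>Embedded submanifold of the ambient space near \<open>p\<close>, by a slice chart; the dimension is that of
  the subspace \<open>V\<close>.\<close>

definition smooth_manifold_near :: "'a::euclidean_space set \<Rightarrow> 'a \<Rightarrow> bool" where
  "smooth_manifold_near M p \<longleftrightarrow> p \<in> M \<and>
     (\<exists>W W' \<phi> \<psi> V. p \<in> W \<and> diffeomorphism W W' \<phi> \<psi> \<and> subspace V \<and> \<phi> ` (M \<inter> W) = V \<inter> W')"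

definition tangent_space :: "'a::euclidean_space \<Rightarrow> 'a set \<Rightarrow> 'a set" where
  "tangent_space p M = {v. \<exists>(c :: real \<Rightarrow> 'a) \<delta>. \<delta> > 0 \<and> smooth_on {-\<delta><..<\<delta>} c \<and>
     c ` {-\<delta><..<\<delta>} \<subseteq> M \<and> c 0 = p \<and> (c has_vector_derivative v) (at 0)}"

definition meet_nontangentially :: "'a::euclidean_space set \<Rightarrow> 'a set \<Rightarrow> 'a \<Rightarrow> bool" where
  "meet_nontangentially M1 M2 p \<longleftrightarrow> p \<in> M1 \<inter> M2 \<and> smooth_manifold_near (M1 \<inter> M2) p \<and>
     tangent_space p (M1 \<inter> M2) = tangent_space p M1 \<inter> tangent_space p M2"

section \<open>Block matrices\<close>

text \<open>With \<open>k = CARD('k)\<close> and \<open>m = CARD('m)\<close>, the index set \<open>{1..N}\<close>, \<open>N = (k+1)m\<close>, is rendered as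
  \<open>'k option \<times> 'm\<close>: the first component selects one of the \<open>k+1\<close> blocks (\<open>None\<close> is the leading block,
  called \<open>z\<close>; the blocks \<open>Some j\<close> form \<open>y\<close>), the second a position inside the block.\<close>

type_synonym ('k, 'm) bvec = "real ^ ('k option \<times> 'm)"
type_synonym ('k, 'm) bmat = "real ^ ('k option \<times> 'm) ^ ('k option \<times> 'm)"

definition mat_inner :: "real^'i^'i \<Rightarrow> real^'i^'i \<Rightarrow> real"  (infixl "\<bullet>\<^sub>M" 70) where
  "C \<bullet>\<^sub>M X = trace (C ** X)"

definition outer :: "real^'j \<Rightarrow> real^'i \<Rightarrow> real^'i^'j" where
  "outer x y = (\<chi> a b. x $ a * y $ b)"

definition psd :: "real^'i^'i \<Rightarrow> bool" where
  "psd X \<longleftrightarrow> transpose X = X \<and> (\<forall>x. 0 \<le> x \<bullet> (X *v x))"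

text \<open>Transposes every \<open>m \<times> m\<close> block in place.\<close>

definition block_transpose :: "('k::finite, 'm::finite) bmat \<Rightarrow> ('k, 'm) bmat" where
  "block_transpose M = (\<chi> I J. M $ (fst I, snd J) $ (fst J, snd I))"

definition block_symmetric :: "('k::finite, 'm::finite) bmat set" where
  "block_symmetric = {X. transpose X = X \<and> block_transpose X = X}"

definition block_symmetric_perp :: "('k::finite, 'm::finite) bmat set" where
  "block_symmetric_perp = {C. transpose C = C \<and> (\<forall>X\<in>block_symmetric. C \<bullet>\<^sub>M X = 0)}"

definition bSym :: "('k::finite, 'm::finite) bmat \<Rightarrow> ('k, 'm) bmat" where
  "bSym M = (let P = (1/2) *\<^sub>R (M + transpose M) in (1/2) *\<^sub>R (P + block_transpose P))"

definition zz_block :: "('k::finite, 'm::finite) bmat \<Rightarrow> real^'m^'m" where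
  "zz_block X = (\<chi> a b. X $ (None, a) $ (None, b))"

definition yy_block :: "('k::finite, 'm::finite) bmat \<Rightarrow> real^('k \<times> 'm)^('k \<times> 'm)" where
  "yy_block X = (\<chi> I J. X $ (Some (fst I), snd I) $ (Some (fst J), snd J))"

text \<open>The block diagonal matrix with blocks \<open>-\<gamma> I\<^sub>m\<close> and \<open>I\<^sub>m\<^sub>k\<close>.\<close>

definition obj_mat :: "real \<Rightarrow> ('k::finite, 'm::finite) bmat" where
  "obj_mat \<gamma> = (\<chi> I J. if I = J then (case fst I of None \<Rightarrow> -\<gamma> | Some _ \<Rightarrow> 1) else 0)"

text \<open>\<open>kron_vec\<close> is the Kronecker product of vectors, \<open>homog v\<close> is the vector \<open>(1; v)\<close>.\<close>

definition kron_vec :: "real^'i \<Rightarrow> real^'m \<Rightarrow> real^('i::finite \<times> 'm::finite)" where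
  "kron_vec w z = (\<chi> I. w $ fst I * z $ snd I)"

definition homog :: "real^'k \<Rightarrow> real^('k::finite option)" where
  "homog v = (\<chi> p. case p of None \<Rightarrow> 1 | Some j \<Rightarrow> v $ j)"

section \<open>The nearest point problem and its SDP relaxation\<close>

definition affine_map :: "('a::real_vector \<Rightarrow> 'b::real_vector) \<Rightarrow> bool" where
  "affine_map f \<longleftrightarrow> (\<exists>L c. linear L \<and> (\<forall>x. f x = L x + c))"

definition deficient_params :: "(real^'k \<Rightarrow> real^'n^'m) \<Rightarrow> (real^'k) set" where
  "deficient_params S = {u. rank (S u) < CARD('m)}"

definition coeff_A :: "(real^'k \<Rightarrow> real^'n^'m) \<Rightarrow> real^'k \<Rightarrow> real^'n^'m" where
  "coeff_A S \<theta> = S \<theta>"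

definition coeff_B :: "(real^'k \<Rightarrow> real^'n^'m) \<Rightarrow> 'k \<Rightarrow> real^'n^'m" where
  "coeff_B S j = S (axis j 1) - S 0"

lemma affine_map_expansion:
  fixes S :: "real^'k \<Rightarrow> real^'n^'m"
  assumes "affine_map S"
  shows "S (v + \<theta>) = coeff_A S \<theta> + (\<Sum>j\<in>UNIV. v $ j *\<^sub>R coeff_B S j)"
proof -
  obtain L c where L: "linear L" and S: "\<And>x. S x = L x + c"
    using assms by (auto simp: affine_map_def)
  have "L v = L (\<Sum>j\<in>UNIV. v $ j *\<^sub>R axis j 1)"
    using basis_expansion[of v] by (simp add: scalar_mult_eq_scaleR)
  also have "\<dots> = (\<Sum>j\<in>UNIV. v $ j *\<^sub>R L (axis j 1))"
    by (simp add: linear_sum[OF L] linear_scale[OF L])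
  finally show ?thesis
    by (simp add: S coeff_A_def coeff_B_def linear_add[OF L] linear_0[OF L])
qed

text \<open>The \<open>i\<close>-th column of the vertical concatenation of \<open>A\<^sub>\<theta>, B\<^sub>1, \<dots>, B\<^sub>k\<close>.\<close>

definition stacked_col ::
    "(real^'k::finite \<Rightarrow> real^'n::finite^'m::finite) \<Rightarrow> real^'k \<Rightarrow> 'n \<Rightarrow> ('k, 'm) bvec" where
  "stacked_col S \<theta> i =
     (\<chi> I. case fst I of None \<Rightarrow> coeff_A S \<theta> $ snd I $ i | Some j \<Rightarrow> coeff_B S j $ snd I $ i)"

definition constraint_mat ::
    "(real^'k::finite \<Rightarrow> real^'n::finite^'m::finite) \<Rightarrow> real^'k \<Rightarrow> 'n \<Rightarrow> 'k option \<times> 'm \<Rightarrow> ('k, 'm) bmat" where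
  "constraint_mat S \<theta> i j = bSym (outer (stacked_col S \<theta> i) (axis j 1))"

definition sdp_feasible ::
    "(real^'k::finite \<Rightarrow> real^'n::finite^'m::finite) \<Rightarrow> real^'k \<Rightarrow> ('k, 'm) bmat \<Rightarrow> bool" where
  "sdp_feasible S \<theta> X \<longleftrightarrow> trace (zz_block X) = 1 \<and> (\<forall>i j. constraint_mat S \<theta> i j \<bullet>\<^sub>M X = 0) \<and>
     X \<in> block_symmetric \<and> psd X"

definition sdp_minimizer ::
    "(real^'k::finite \<Rightarrow> real^'n::finite^'m::finite) \<Rightarrow> real^'k \<Rightarrow> ('k, 'm) bmat \<Rightarrow> bool" where
  "sdp_minimizer S \<theta> = is_arg_min (\<lambda>X. trace (yy_block X)) (sdp_feasible S \<theta>)"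

definition dual_feasible ::
    "(real^'k::finite \<Rightarrow> real^'n::finite^'m::finite) \<Rightarrow> real^'k \<Rightarrow>
     real \<Rightarrow> ('n \<Rightarrow> 'k option \<times> 'm \<Rightarrow> real) \<Rightarrow> ('k, 'm) bmat \<Rightarrow> bool" where
  "dual_feasible S \<theta> \<gamma> \<mu> Sig \<longleftrightarrow> Sig \<in> block_symmetric_perp \<and>
     psd (obj_mat \<gamma> - (\<Sum>i\<in>UNIV. \<Sum>j\<in>UNIV. \<mu> i j *\<^sub>R constraint_mat S \<theta> i j) - Sig)"

text \<open>Optimal values are extended reals, so that no convention about infeasible or unbounded problems
  is hidden in them.\<close>

definition nearest_val :: "(real^'k \<Rightarrow> real^'n^'m) \<Rightarrow> real^'k \<Rightarrow> ereal" where
  "nearest_val S \<theta> = (INF u\<in>deficient_params S. ereal ((norm (u - \<theta>))\<^sup>2))"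

definition sdp_val :: "(real^'k::finite \<Rightarrow> real^'n::finite^'m::finite) \<Rightarrow> real^'k \<Rightarrow> ereal" where
  "sdp_val S \<theta> = (INF X\<in>{X. sdp_feasible S \<theta> X}. ereal (trace (yy_block X)))"

definition dual_val :: "(real^'k::finite \<Rightarrow> real^'n::finite^'m::finite) \<Rightarrow> real^'k \<Rightarrow> ereal" where
  "dual_val S \<theta> = (SUP \<gamma>\<in>{\<gamma>. \<exists>\<mu> Sig. dual_feasible S \<theta> \<gamma> \<mu> Sig}. ereal \<gamma>)"

definition relaxation_exact ::
    "(real^'k::finite \<Rightarrow> real^'n::finite^'m::finite) \<Rightarrow> real^'k \<Rightarrow> bool" where
  "relaxation_exact S \<theta> \<longleftrightarrow> nearest_val S \<theta> = sdp_val S \<theta> \<and> sdp_val S \<theta> = dual_val S \<theta> \<and>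
     (\<exists>X. {X'. sdp_minimizer S \<theta> X'} = {X} \<and> rank X = 1)"

definition nearest_point :: "(real^'k \<Rightarrow> real^'n^'m) \<Rightarrow> real^'k \<Rightarrow> real^'k \<Rightarrow> bool" where
  "nearest_point S \<theta> = is_arg_min (\<lambda>u. (norm (u - \<theta>))\<^sup>2) (\<lambda>u. u \<in> deficient_params S)"

text \<open>\<open>u\<close> is read off a minimizer \<open>X = x x\<^sup>T\<close> of the SDP, \<open>x = (1; v) \<otimes> z\<close> with \<open>z\<close> a unit vector, as
  \<open>u = \<theta> + v\<close>.\<close>

definition recovered_point ::
    "(real^'k::finite \<Rightarrow> real^'n::finite^'m::finite) \<Rightarrow> real^'k \<Rightarrow> real^'k \<Rightarrow> bool" where
  "recovered_point S \<theta> u \<longleftrightarrow> (\<exists>X v z. sdp_minimizer S \<theta> X \<and> norm z = 1 \<and>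
     X = outer (kron_vec (homog v) z) (kron_vec (homog v) z) \<and> u = \<theta> + v)"

end

theory Submission
  imports Defs
begin

text \<open>Let \<open>L\<close> be the linear part of \<open>S\<close>, let \<open>B\<^sub>j\<close> be its coefficients, and write \<open>s\<^sub>i\<close> for the stacked
  columns. At \<open>\<theta>bar\<close> the optimal value is \<open>0\<close> and a certificate of optimality is the form
  \<open>\<parallel>y\<parallel>\<^sup>2 + \<Sum>\<^sub>i (s\<^sub>i \<bullet> x)\<^sup>2\<close> in the vector \<open>x = (z; y)\<close>, which is positive semidefinite with the line spanned by
  \<open>(1; 0) \<otimes> z0\<close> as kernel, \<open>z0\<close> being a unit left null vector of \<open>S \<theta>bar\<close>. The idea is to move this
  certificate continuously to nearby \<open>\<theta>\<close>.

  Let \<open>u\<close> be a nearest point to \<open>\<theta>\<close> and \<open>v = u - \<theta>\<close>. Suppose that \<open>v\<^sub>j = - z \<bullet> B\<^sub>j l\<close> with \<open>z\<close> a unit left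
  null vector and \<open>l\<close> a right null vector of \<open>S u\<close>. Then \<open>l\<close> serves as a Lagrange multiplier: the form
  \<open>\<parallel>y\<parallel>\<^sup>2 - \<parallel>v\<parallel>\<^sup>2 \<parallel>z'\<parallel>\<^sup>2 + \<Sum>\<^sub>i (s\<^sub>i \<bullet> x)\<^sup>2\<close> in \<open>x = (z'; y)\<close>, plus a coupling term linear in \<open>l\<close>, has
  \<open>(1; v) \<otimes> z\<close> in its kernel (\<open>certificate_kernel\<close>) and, once it is positive semidefinite, shows that \<open>\<parallel>v\<parallel>\<^sup>2\<close> is
  a lower bound for the relaxation (\<open>certificate_dual_feasible\<close>). A small perturbation of a form that is
  definite on a hyperplane, having a null vector off that hyperplane, is semidefinite with that null
  vector spanning the kernel (\<open>eventually_psd_with_kernel\<close>). So if \<open>v\<close> and \<open>l\<close> are small and \<open>z\<close> is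
  close to \<open>z0\<close>, the certificate is positive semidefinite, the duality gap is zero, and complementarity
  forces every minimizer to be the rank-one matrix of the vector \<open>(1; v) \<otimes> z\<close>
  (\<open>exact_if_certificate\<close>).

  Non-tangentiality provides the small multiplier (\<open>residual_is_normal\<close>). At \<open>\<theta>bar\<close> it says that
  every parameter vector is the sum of a velocity of the deficient set and of a normal vector with
  components \<open>z0 \<bullet> B\<^sub>j l\<close> (\<open>nontangential_splitting\<close>). Velocities persist at nearby points because the
  intersection is a manifold (\<open>smooth_manifold_velocities_near\<close>), and normal vectors persist because
  kernels of matrices of constant rank are continuous (\<open>eventually_kernel_near\<close>). Hence both
  kinds together still span the whole space at nearby \<open>u\<close>, with uniform bounds, and they are orthogonal
  to each other. By first-order optimality \<open>v\<close> is orthogonal to all velocities, so it is a normal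
  vector, and its multiplier is bounded by a constant times \<open>\<parallel>v\<parallel> \<le> \<parallel>\<theta> - \<theta>bar\<parallel>\<close>.\<close>

section \<open>Ranks and kernels near a given matrix\<close>

lemma bounded_bilinear_matrix_vector:
  "bounded_bilinear ((*v) :: real^'n^'m \<Rightarrow> real^'n \<Rightarrow> real^'m)"
  unfolding bilinear_conv_bounded_bilinear[symmetric] bilinear_def
  by (auto intro!: linearI simp: algebra_simps scaleR_matrix_vector_assoc)

lemma bounded_bilinear_matrix_matrix:
  "bounded_bilinear ((**) :: real^'n^'m \<Rightarrow> real^'p^'n \<Rightarrow> real^'p^'m)"
  unfolding bilinear_conv_bounded_bilinear[symmetric] bilinear_def
  by (auto intro!: linearI
      simp: matrix_matrix_mult_def vec_eq_iff sum.distrib algebra_simps sum_distrib_left)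

lemmas matrix_vector_tendsto = bounded_bilinear.tendsto[OF bounded_bilinear_matrix_vector]
lemmas matrix_matrix_tendsto = bounded_bilinear.tendsto[OF bounded_bilinear_matrix_matrix]

text \<open>A Neumann-series estimate: an operator close to the identity is invertible, and solving with it moves
  the right-hand side only slightly. It serves for matrices near a given one and for bases near the
  coordinate basis.\<close>

lemma near_identity_solve:
  fixes T :: "'a::euclidean_space \<Rightarrow> 'a"
  assumes T: "linear T" and near: "\<And>x. norm (T x - x) \<le> e * norm x" and e: "e \<le> 1/2"
  obtains y where "T y = x" "norm y \<le> 2 * norm x" "norm (y - x) \<le> e * (2 * norm x)"
proof -
  have low: "norm y \<le> 2 * norm (T y)" for y
  proof -
    have "norm y \<le> norm (T y) + norm (T y - y)"
      using norm_triangle_ineq4[of "T y" "T y - y"] by simp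
    also have "norm (T y - y) \<le> 1/2 * norm y"
      using near[of y] mult_right_mono[OF e norm_ge_zero[of y]] by linarith
    finally show ?thesis by simp
  qed
  have "inj T"
    unfolding linear_injective_0[OF T] using low by (metis mult_zero_right norm_le_zero_iff norm_zero)
  then obtain y where y: "T y = x"
    using linear_injective_imp_surjective[OF T] by (metis surjD)
  have "norm (y - x) \<le> e * norm y"
    using near[of y] y by (simp add: norm_minus_commute)
  moreover have "e \<ge> 0" if "norm y \<noteq> 0"
  proof -
    have "0 \<le> e * norm y" using near[of y] norm_ge_zero order_trans by blast
    then show ?thesis using that by (simp add: zero_le_mult_iff)
  qed
  moreover have "norm y \<le> 2 * norm x" using low[of y] y by simp
  ultimately have "norm (y - x) \<le> e * (2 * norm x)"
    by (cases "norm y = 0") (use y T linear_0[OF T] in \<open>auto intro: order_trans mult_left_mono\<close>)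
  with y low[of y] show thesis by (intro that) auto
qed

lemma ex_generalized_inverse:
  fixes A :: "real^'n^'m"
  obtains P :: "real^'m^'n" where "A ** P ** A = A"
proof -
  obtain g where g: "linear g" "\<And>v. v \<in> range ((*v) A) \<Longrightarrow> A *v g v = v"
    using linear_exists_right_inverse_on[OF matrix_vector_mul_linear subspace_UNIV, of A] by blast
  have "A ** matrix g ** A = A"
    unfolding matrix_eq by (simp add: matrix_vector_mul_assoc[symmetric] fun_cong[OF matrix_vector_mul(2)[OF g(1)]] g(2))
  then show thesis by (rule that)
qed

text \<open>If \<open>A P A = A\<close> and \<open>J = I + P (B - A)\<close> (the map \<open>T\<close> of the proof), then \<open>A J = A P B\<close>; for \<open>B\<close> near \<open>A\<close> the matrix \<open>J\<close> is
  near the identity. This intertwining transfers rank and kernel between \<open>A\<close> and \<open>B\<close>.\<close>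

lemma eventually_intertwined:
  fixes A :: "real^'n^'m"
  assumes "0 < \<epsilon>"
  obtains P :: "real^'m^'n" where "\<forall>\<^sub>F B in nhds A. \<forall>x. \<exists>y.
    A *v x = A *v (P *v (B *v y)) \<and> norm (y - x) \<le> \<epsilon> * norm x"
proof -
  obtain P :: "real^'m^'n" where P: "A ** P ** A = A" by (rule ex_generalized_inverse)
  obtain K where K: "\<And>(M :: real^'n^'n) x. norm (M *v x) \<le> norm M * norm x * K"
    using bounded_bilinear.pos_bounded[OF bounded_bilinear_matrix_vector] by blast
  define e where "e = min (\<epsilon>/2) (1/2)"
  have e: "e > 0" "e \<le> 1/2" "e * 2 \<le> \<epsilon>" using assms by (auto simp: e_def)
  have "((\<lambda>B. norm (P ** (B - A)) * K) \<longlongrightarrow> norm (P ** (A - A)) * K) (nhds A)"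
    by (intro tendsto_intros matrix_matrix_tendsto filterlim_ident)
  then have "((\<lambda>B. norm (P ** (B - A)) * K) \<longlongrightarrow> 0) (nhds A)"
    by (simp add: bounded_bilinear.zero_right[OF bounded_bilinear_matrix_matrix])
  then have "\<forall>\<^sub>F B in nhds A. norm (P ** (B - A)) * K < e"
    using e by (simp add: order_tendsto_iff)
  then have "\<forall>\<^sub>F B in nhds A. \<forall>x. \<exists>y.
      A *v x = A *v (P *v (B *v y)) \<and> norm (y - x) \<le> \<epsilon> * norm x"
  proof eventually_elim
    case (elim B)
    define T where "T y = y + P *v ((B - A) *v y)" for y
    have T: "linear T"
      unfolding T_def by (intro linearI) (auto simp: algebra_simps)
    have near: "norm (T y - y) \<le> e * norm y" for y
    proof -
      have "norm (T y - y) \<le> norm (P ** (B - A)) * norm y * K"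
        using K[of "P ** (B - A)" y] by (simp add: T_def matrix_vector_mul_assoc)
      also have "\<dots> = (norm (P ** (B - A)) * K) * norm y" by simp
      also have "\<dots> \<le> e * norm y" using elim by (intro mult_right_mono) auto
      finally show ?thesis .
    qed
    have AT: "A *v T y = A *v (P *v (B *v y))" for y
    proof -
      have "A *v (P *v (A *v y)) = A *v y"
        by (metis P matrix_vector_mul_assoc)
      then show ?thesis by (simp add: T_def algebra_simps)
    qed
    show ?case
    proof
      fix x
      obtain y where y: "T y = x" "norm (y - x) \<le> e * (2 * norm x)"
        using near_identity_solve[OF T near e(2)] by metis
      have "e * (2 * norm x) \<le> \<epsilon> * norm x"
        using mult_right_mono[OF e(3) norm_ge_zero[of x]] by (simp add: mult.assoc)
      then show "\<exists>y. A *v x = A *v (P *v (B *v y)) \<and> norm (y - x) \<le> \<epsilon> * norm x"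
        using y AT[of y] by (intro exI[of _ y]) auto
    qed
  qed
  then show thesis by (rule that)
qed

text \<open>The identity \<open>A J = A P B\<close> with \<open>J\<close> invertible shows that \<open>A\<close> factors through \<open>B\<close>.\<close>

lemma eventually_rank_ge:
  fixes A :: "real^'n^'m"
  shows "\<forall>\<^sub>F B in nhds A. rank A \<le> rank B"
proof -
  obtain P :: "real^'m^'n" where "\<forall>\<^sub>F B in nhds A. \<forall>x. \<exists>y.
      A *v x = A *v (P *v (B *v y)) \<and> norm (y - x) \<le> 1 * norm x"
    by (rule eventually_intertwined[of 1]) auto
  then show ?thesis
  proof eventually_elim
    case (elim B)
    have "range ((*v) A) \<subseteq> range ((*v) (A ** P ** B))"
    proof
      fix w assume "w \<in> range ((*v) A)"
      then obtain x where "w = A *v x" by auto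
      with elim obtain y where "w = (A ** P ** B) *v y"
        by (metis matrix_vector_mul_assoc)
      then show "w \<in> range ((*v) (A ** P ** B))" by auto
    qed
    then have "rank A \<le> rank (A ** P ** B)"
      unfolding rank_dim_range by (rule dim_subset)
    then show ?case using rank_mul_le_right[of "A ** P" B] by simp
  qed
qed

lemma linear_inj_on_if_dim_le:
  fixes f :: "'a::euclidean_space \<Rightarrow> 'b::euclidean_space"
  assumes f: "linear f" and V: "subspace V" and le: "dim V \<le> dim (f ` V)"
  shows "inj_on f V"
proof -
  obtain Bs where Bs: "Bs \<subseteq> V" "independent Bs" "V \<subseteq> span Bs" "card Bs = dim V"
    using basis_exists by blast
  have fin: "finite Bs" using Bs(2) by (rule independent_imp_finite)
  have spn: "span Bs = V" using Bs V by (metis span_minimal subset_antisym)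
  have img: "f ` V \<subseteq> span (f ` Bs)"
    using linear_span_image[OF f, of Bs] spn by simp
  have c: "card (f ` Bs) \<le> dim (f ` V)"
    using card_image_le[OF fin, of f] Bs(4) le by simp
  have ind: "independent (f ` Bs)"
    by (rule card_le_dim_spanning[OF _ img _ c]) (use Bs fin in auto)
  have "dim (f ` V) \<le> card (f ` Bs)"
    by (rule dim_le_card[OF img]) (use fin in auto)
  then have "inj_on f Bs"
    using Bs(4) le card_image_le[OF fin, of f] by (intro eq_card_imp_inj_on fin) linarith
  then have "inj_on f (span Bs)"
    using linear_inj_on_span_independent_image[OF f ind] by blast
  then show ?thesis using spn by simp
qed

text \<open>Solve \<open>J y = x\<close> with the matrix \<open>J\<close> near the identity for which \<open>A J = A P B\<close>. Then \<open>A P\<close> kills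
  \<open>B y\<close>. As \<open>A P\<close> maps the range of \<open>B\<close> onto at least the range of \<open>A\<close>, the bound \<open>rank B \<le> rank A\<close>
  makes it injective there, so that \<open>B y = 0\<close>. Without that bound the kernel could collapse.\<close>

lemma eventually_kernel_near:
  fixes A :: "real^'n^'m"
  assumes x: "A *v x = 0" and "0 < \<epsilon>"
  shows "\<forall>\<^sub>F B in nhds A. rank B \<le> rank A \<longrightarrow> (\<exists>y. B *v y = 0 \<and> norm (y - x) < \<epsilon>)"
proof -
  define e where "e = \<epsilon> / (norm x + 1)"
  have e: "0 < e" "e * norm x < \<epsilon>"
    using assms(2) by (auto simp: e_def field_simps add_pos_nonneg add_nonneg_pos)
  obtain P :: "real^'m^'n" where "\<forall>\<^sub>F B in nhds A. \<forall>x. \<exists>y.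
      A *v x = A *v (P *v (B *v y)) \<and> norm (y - x) \<le> e * norm x"
    by (rule eventually_intertwined[OF e(1)]) auto
  then show ?thesis
  proof eventually_elim
    case (elim B)
    show ?case
    proof
      assume rk: "rank B \<le> rank A"
      have sub: "range ((*v) A) \<subseteq> (*v) (A ** P) ` range ((*v) B)"
      proof
        fix w assume "w \<in> range ((*v) A)"
        then obtain x where "w = A *v x" by auto
        with elim obtain y where "w = (A ** P) *v (B *v y)"
          by (metis matrix_vector_mul_assoc)
        then show "w \<in> (*v) (A ** P) ` range ((*v) B)" by auto
      qed
      have V: "subspace (range ((*v) B))"
        by (intro linear_subspace_image matrix_vector_mul_linear subspace_UNIV)
      have "dim (range ((*v) B)) \<le> dim ((*v) (A ** P) ` range ((*v) B))"
        using rk dim_subset[OF sub] by (simp add: rank_dim_range)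
      then have inj: "inj_on ((*v) (A ** P)) (range ((*v) B))"
        by (intro linear_inj_on_if_dim_le V matrix_vector_mul_linear)
      obtain y where y: "A *v x = A *v (P *v (B *v y))" "norm (y - x) \<le> e * norm x"
        using elim by blast
      have "(A ** P) *v (B *v y) = (A ** P) *v (B *v 0)"
        using y(1) x by (simp add: matrix_vector_mul_assoc[symmetric])
      then have "B *v y = B *v 0" by (rule inj_onD[OF inj _ rangeI rangeI])
      then show "\<exists>y. B *v y = 0 \<and> norm (y - x) < \<epsilon>"
        using y(2) e(2) by (intro exI[of _ y]) auto
    qed
  qed
qed

section \<open>Velocities of constant-rank matrices and of submanifolds\<close>

text \<open>Tangent vectors without smoothness of the curve: first-order arguments need only the velocity, and
  these vectors are easier to produce at points near a given one.\<close>

definition curve_velocity :: "'a::real_normed_vector set \<Rightarrow> 'a \<Rightarrow> 'a \<Rightarrow> bool" where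
  "curve_velocity M q \<sigma> \<longleftrightarrow>
     (\<exists>c. (c has_vector_derivative \<sigma>) (at 0) \<and> c 0 = q \<and> (\<forall>\<^sub>F t in nhds (0::real). c t \<in> M))"

lemma velocity_tendsto:
  fixes c :: "real \<Rightarrow> 'a::real_normed_vector"
  assumes "(c has_vector_derivative \<tau>) (at 0)"
  shows "((\<lambda>t. (c t - c 0) /\<^sub>R t) \<longlongrightarrow> \<tau>) (at 0)"
proof -
  have "((\<lambda>t. norm (c t - c 0 - t *\<^sub>R \<tau>) / norm t) \<longlongrightarrow> 0) (at 0)"
    using assms by (simp add: has_vector_derivative_def has_derivative_at)
  then have "((\<lambda>t. norm ((c t - c 0) /\<^sub>R t - \<tau>)) \<longlongrightarrow> 0) (at 0)"
  proof (rule Lim_transform_eventually)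
    have "norm (c t - c 0 - t *\<^sub>R \<tau>) / norm t = norm ((c t - c 0) /\<^sub>R t - \<tau>)" if "t \<noteq> 0" for t
    proof -
      have "(c t - c 0) /\<^sub>R t - \<tau> = (c t - c 0 - t *\<^sub>R \<tau>) /\<^sub>R t"
        using that by (simp add: algebra_simps)
      then show ?thesis by (simp add: divide_inverse mult.commute)
    qed
    then show "\<forall>\<^sub>F t in at 0. norm (c t - c 0 - t *\<^sub>R \<tau>) / norm t = norm ((c t - c 0) /\<^sub>R t - \<tau>)"
      by (auto simp: eventually_at_filter)
  qed
  then have "((\<lambda>t. (c t - c 0) /\<^sub>R t - \<tau>) \<longlongrightarrow> 0) (at 0)"
    by (simp add: tendsto_norm_zero_iff)
  then show ?thesis by (simp add: LIM_zero_iff)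
qed

lemma velocity_in_subspace:
  fixes c :: "real \<Rightarrow> 'a::euclidean_space"
  assumes "(c has_vector_derivative \<tau>) (at 0)" and V: "subspace V"
    and "\<forall>\<^sub>F t in nhds 0. c t - c 0 \<in> V"
  shows "\<tau> \<in> V"
proof (rule Lim_in_closed_set[OF closed_subspace[OF V] _ _ velocity_tendsto[OF assms(1)]])
  show "\<forall>\<^sub>F t in at 0. (c t - c 0) /\<^sub>R t \<in> V"
    using assms(3) by (auto simp: eventually_at_filter subspace_scale[OF V] elim!: eventually_mono)
qed auto

lemma curve_continuous:
  assumes "(c has_vector_derivative \<tau>) (at 0)"
  shows "filterlim c (nhds (c 0)) (nhds 0)"
  using has_vector_derivative_continuous[OF assms]
  by (simp add: continuous_at tendsto_nhds_iff)

text \<open>Let \<open>c\<close> be a curve with velocity \<open>\<tau>\<close>. If \<open>x\<close> is in the kernel of \<open>A = c 0\<close>, then some \<open>y\<close> near \<open>x\<close> lies in the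
  kernel of \<open>c t\<close>, and for the left null vector \<open>z\<close> of \<open>A\<close> the number \<open>z \<bullet> (c t - c 0) y\<close> vanishes.
  Dividing by \<open>t\<close> and passing to the limit gives the claim.\<close>

lemma constant_rank_velocity:
  fixes A \<tau> :: "real^'n^'m"
  assumes vel: "curve_velocity {B. rank B \<le> rank A} A \<tau>"
    and z: "z v* A = 0" and x: "A *v x = 0"
  shows "z \<bullet> (\<tau> *v x) = 0"
proof (rule ccontr)
  obtain c where c: "(c has_vector_derivative \<tau>) (at 0)" and c0: "c 0 = A"
    and rk: "\<forall>\<^sub>F t in nhds 0. rank (c t) \<le> rank A"
    using vel unfolding curve_velocity_def by auto
  assume ne: "z \<bullet> (\<tau> *v x) \<noteq> 0"
  have "((\<lambda>p. z \<bullet> (fst p *v snd p)) \<longlongrightarrow> z \<bullet> (\<tau> *v x)) (nhds \<tau> \<times>\<^sub>F nhds x)"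
    by (intro tendsto_intros matrix_vector_tendsto filterlim_fst filterlim_snd)
  then have "\<forall>\<^sub>F p in nhds \<tau> \<times>\<^sub>F nhds x. z \<bullet> (fst p *v snd p) \<noteq> 0"
    using ne by (rule tendsto_imp_eventually_ne)
  then obtain P Q where PQ: "eventually P (nhds \<tau>)" "eventually Q (nhds x)"
    "\<And>D y. P D \<Longrightarrow> Q y \<Longrightarrow> z \<bullet> (D *v y) \<noteq> 0"
    unfolding eventually_prod_filter by auto
  obtain \<epsilon> where eps: "\<epsilon> > 0" "\<And>y. norm (y - x) < \<epsilon> \<Longrightarrow> Q y"
    using PQ(2) by (auto simp: eventually_nhds_metric dist_norm)
  have "\<forall>\<^sub>F t in nhds 0. rank (c t) \<le> rank A \<longrightarrow> (\<exists>y. c t *v y = 0 \<and> norm (y - x) < \<epsilon>)"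
    using eventually_kernel_near[OF x eps(1)] curve_continuous[OF c, unfolded c0]
    by (rule eventually_compose_filterlim)
  with rk have ker: "\<forall>\<^sub>F t in at 0. \<exists>y. c t *v y = 0 \<and> norm (y - x) < \<epsilon>"
    unfolding eventually_at_filter by eventually_elim auto
  have "\<forall>\<^sub>F t in at 0. P ((c t - c 0) /\<^sub>R t)"
    using PQ(1) velocity_tendsto[OF c] by (rule eventually_compose_filterlim)
  with ker have "\<forall>\<^sub>F t in at (0::real). False"
  proof eventually_elim
    case (elim t)
    then obtain y where y: "c t *v y = 0" "norm (y - x) < \<epsilon>" by auto
    have "z \<bullet> (c 0 *v y) = 0" using z c0 by (simp add: dot_lmul_matrix[symmetric])
    then have "z \<bullet> (((c t - c 0) /\<^sub>R t) *v y) = 0"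
      using y(1) by (simp add: scaleR_matrix_vector_assoc[symmetric] algebra_simps)
    then show False using PQ(3) elim(2) eps(2) y(2) by blast
  qed
  then show False by simp
qed

text \<open>Directional derivatives of quadratic curves are again of this form, so induction on \<open>r\<close> closes.
  Quadratic curves suffice to exhibit the tangent vectors of both intersecting sets.\<close>

lemma Ck_on_quadratic: "Ck_on r U (\<lambda>t::real. C0 + t *\<^sub>R C1 + t\<^sup>2 *\<^sub>R C2)"
proof (induction r arbitrary: C0 C1 C2)
  case 0
  show ?case by (auto intro!: continuous_intros)
next
  case (Suc r)
  have D: "((\<lambda>t::real. C0 + t *\<^sub>R C1 + t\<^sup>2 *\<^sub>R C2) has_derivative
      (\<lambda>v. v *\<^sub>R C1 + (2 * x * v) *\<^sub>R C2)) (at x)" for x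
    by (auto intro!: derivative_eq_intros simp: algebra_simps)
  have eq: "frechet_derivative (\<lambda>t::real. C0 + t *\<^sub>R C1 + t\<^sup>2 *\<^sub>R C2) (at x) v
      = v *\<^sub>R C1 + x *\<^sub>R ((2 * v) *\<^sub>R C2) + x\<^sup>2 *\<^sub>R 0" for x v
    unfolding frechet_derivative_at[OF D[of x], symmetric] by (simp add: mult_ac)
  have "Ck_on r U (\<lambda>x. frechet_derivative (\<lambda>t. C0 + t *\<^sub>R C1 + t\<^sup>2 *\<^sub>R C2) (at x) v)" for v
    unfolding eq by (rule Suc.IH)
  moreover have "(\<lambda>t. C0 + t *\<^sub>R C1 + t\<^sup>2 *\<^sub>R C2) differentiable (at x)" for x :: real
    using D unfolding differentiable_def by blast
  ultimately show ?case by simp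
qed

text \<open>With \<open>A P A = A\<close> the matrices \<open>E = I - A P\<close> and \<open>F = I - P A\<close> project onto the left and right
  kernels, so that \<open>E \<tau> F = 0\<close> and \<open>\<tau> = X A + A Y\<close>. The curve \<open>(I + t X) A (I + t Y)\<close> then stays in the
  set of matrices of the same rank.\<close>

lemma tangent_space_constant_rank:
  fixes A \<tau> :: "real^'n^'m"
  assumes nul: "\<And>z x. z v* A = 0 \<Longrightarrow> A *v x = 0 \<Longrightarrow> z \<bullet> (\<tau> *v x) = 0"
  shows "\<tau> \<in> tangent_space A {B. rank B = rank A}"
proof -
  obtain P :: "real^'m^'n" where P: "A ** P ** A = A" by (rule ex_generalized_inverse)
  have P': "A *v (P *v (A *v x)) = A *v x" for x
    by (metis P matrix_vector_mul_assoc)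
  define X where "X = (\<tau> - A ** P ** \<tau>) ** P"
  define Y where "Y = P ** \<tau>"
  have dec: "\<tau> = X ** A + A ** Y"
    unfolding matrix_eq
  proof
    fix x
    define f where "f = x - P *v (A *v x)"
    have f: "A *v f = 0" by (simp add: f_def algebra_simps P')
    have "z \<bullet> (\<tau> *v f - A *v (P *v (\<tau> *v f))) = 0" for z
    proof -
      define w where "w = z - z v* (A ** P)"
      have "(w v* A) \<bullet> y = 0" for y
        by (simp add: w_def dot_lmul_matrix algebra_simps matrix_vector_mul_assoc[symmetric] P'
            inner_diff_left)
      then have "w v* A = 0" by (metis inner_eq_zero_iff)
      then have "w \<bullet> (\<tau> *v f) = 0" using nul f by blast
      then show ?thesis
        by (simp add: w_def dot_lmul_matrix inner_diff_left inner_diff_right matrix_vector_mul_assoc[symmetric])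
    qed
    then have "\<tau> *v f - A *v (P *v (\<tau> *v f)) = 0" by (metis inner_eq_zero_iff)
    then show "\<tau> *v x = (X ** A + A ** Y) *v x"
      by (simp add: f_def X_def Y_def algebra_simps matrix_vector_mul_assoc[symmetric])
  qed
  define c where "c t = A + t *\<^sub>R \<tau> + t\<^sup>2 *\<^sub>R (X ** A ** Y)" for t :: real
  have c_alt: "c t = (mat 1 + t *\<^sub>R X) ** A ** (mat 1 + t *\<^sub>R Y)" for t
    unfolding matrix_eq
    by (simp add: c_def dec algebra_simps matrix_vector_mul_assoc[symmetric]
        scaleR_matrix_vector_assoc[symmetric] power2_eq_square)
  have le: "rank (c t) \<le> rank A" for t
    unfolding c_alt by (meson order_trans rank_mul_le_left rank_mul_le_right)
  have der: "(c has_vector_derivative \<tau>) (at 0)"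
    unfolding c_def by (auto intro!: derivative_eq_intros simp: has_vector_derivative_def)
  have c0: "c 0 = A" by (simp add: c_def)
  have "\<forall>\<^sub>F t in nhds 0. rank A \<le> rank (c t)"
    using eventually_rank_ge curve_continuous[OF der, unfolded c0]
    by (rule eventually_compose_filterlim)
  then obtain \<delta> where \<delta>: "\<delta> > 0" "\<And>t. \<bar>t\<bar> < \<delta> \<Longrightarrow> rank A \<le> rank (c t)"
    by (auto simp: eventually_nhds_metric dist_norm)
  show ?thesis
    unfolding tangent_space_def
    using \<delta> le der c0
    by (auto intro!: exI[of _ c] exI[of _ \<delta>] antisym simp: smooth_on_def c_def[abs_def] Ck_on_quadratic)
qed

text \<open>In a slice chart the manifold is a linear subspace, so a velocity at \<open>p\<close> can be transported to a
  nearby point \<open>q\<close> as the image of the same chart vector \<open>e\<close>, and \<open>C\<^sup>1\<close> smoothness of the inverse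
  chart keeps the transported velocity close to the original.\<close>

lemma smooth_manifold_velocities_near:
  fixes M :: "'a::euclidean_space set"
  assumes M: "smooth_manifold_near M p" and \<tau>: "\<tau> \<in> tangent_space p M" and "\<epsilon> > 0"
  shows "\<forall>\<^sub>F q in nhds p. q \<in> M \<longrightarrow> (\<exists>\<sigma>. curve_velocity M q \<sigma> \<and> norm (\<sigma> - \<tau>) < \<epsilon>)"
proof -
  obtain W W' V :: "'a set" and \<phi> \<psi> where W: "p \<in> M" "p \<in> W" "open W" "open W'" and hom: "homeomorphism W W' \<phi> \<psi>"
    and sm: "smooth_on W \<phi>" "smooth_on W' \<psi>" and V: "subspace V" and chart: "\<phi> ` (M \<inter> W) = V \<inter> W'"
    using M unfolding smooth_manifold_near_def diffeomorphism_def by blast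
  have inv: "\<psi> (\<phi> x) = x" "\<phi> x \<in> W'" if "x \<in> W" for x
    using hom that by (auto simp: homeomorphism_def)
  have cont\<phi>: "isCont \<phi> p"
    using hom W by (auto simp: homeomorphism_def continuous_on_eq_continuous_at)
  have "Ck_on (Suc 0) W \<phi>" "Ck_on (Suc 0) W' \<psi>" using sm unfolding smooth_on_def by blast+
  then have d\<phi>: "\<phi> differentiable (at p)" and d\<psi>: "\<And>y. y \<in> W' \<Longrightarrow> \<psi> differentiable (at y)"
    and cd: "\<And>v. continuous_on W' (\<lambda>y. frechet_derivative \<psi> (at y) v)"
    using W by auto
  have D\<psi>: "(\<psi> has_derivative frechet_derivative \<psi> (at y)) (at y)" if "y \<in> W'" for y
    using d\<psi>[OF that] by (simp add: frechet_derivative_works)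
  obtain c0 \<delta> where c0: "\<delta> > 0" "c0 ` {-\<delta><..<\<delta>} \<subseteq> M" "c0 0 = p" "(c0 has_vector_derivative \<tau>) (at 0)"
    using \<tau> unfolding tangent_space_def by auto
  define e where "e = frechet_derivative \<phi> (at p) \<tau>"
  have chain: "((\<lambda>t. g (f t)) has_vector_derivative g' v) (at 0)"
    if "(f has_vector_derivative v) (at 0)" "(g has_derivative g') (at (f 0))"
    for f :: "real \<Rightarrow> 'a" and g :: "'a \<Rightarrow> 'a" and g' v
  proof -
    interpret bounded_linear g' using that(2) by (rule has_derivative_bounded_linear)
    show ?thesis
      using has_derivative_compose[OF that[unfolded has_vector_derivative_def]]
      by (simp add: has_vector_derivative_def scaleR)
  qed
  have e_der: "((\<lambda>t. \<phi> (c0 t)) has_vector_derivative e) (at 0)"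
    unfolding e_def by (rule chain[OF c0(4)]) (use d\<phi> c0(3) in \<open>simp add: frechet_derivative_works\<close>)
  have inW: "\<forall>\<^sub>F t in nhds 0. c0 t \<in> W"
    by (rule eventually_compose_filterlim[OF eventually_nhds_in_open[OF W(3)] curve_continuous[OF c0(4)]])
      (simp add: W(2) c0(3))
  have "\<forall>\<^sub>F t in nhds 0. t \<in> {-\<delta><..<\<delta>}"
    by (rule eventually_nhds_in_open) (use c0 in auto)
  with inW have c0M: "\<forall>\<^sub>F t in nhds 0. c0 t \<in> M \<inter> W"
    by eventually_elim (use c0 in auto)
  have "e \<in> V"
  proof (rule velocity_in_subspace[OF e_der V])
    show "\<forall>\<^sub>F t in nhds 0. \<phi> (c0 t) - \<phi> (c0 0) \<in> V"
      using c0M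
    proof eventually_elim
      case (elim t)
      then have "\<phi> (c0 t) \<in> V" "\<phi> (c0 0) \<in> V" using chart W c0(3) by auto
      then show ?case by (rule subspace_diff[OF V])
    qed
  qed
  have "((\<lambda>t. \<psi> (\<phi> (c0 t))) has_vector_derivative frechet_derivative \<psi> (at (\<phi> p)) e) (at 0)"
    by (rule chain[OF e_der]) (use D\<psi> inv W c0(3) in auto)
  moreover have "((\<lambda>t. \<psi> (\<phi> (c0 t))) has_vector_derivative \<tau>) (at 0)"
  proof -
    obtain S where "open S" "0 \<in> S" "\<And>t. t \<in> S \<Longrightarrow> c0 t \<in> W"
      using inW unfolding eventually_nhds by auto
    then show ?thesis
      by (intro has_vector_derivative_transform_within_open[OF c0(4) \<open>open S\<close>]) (auto simp: inv)
  qed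
  ultimately have \<tau>_eq: "frechet_derivative \<psi> (at (\<phi> p)) e = \<tau>"
    by (rule vector_derivative_unique_at)
  have "isCont (\<lambda>y. frechet_derivative \<psi> (at y) e) (\<phi> p)"
    using cd W inv by (simp add: continuous_on_eq_continuous_at)
  then have "isCont (\<lambda>q. frechet_derivative \<psi> (at (\<phi> q)) e) p"
    using cont\<phi> by (rule isCont_o2[rotated])
  then have "((\<lambda>q. frechet_derivative \<psi> (at (\<phi> q)) e) \<longlongrightarrow> \<tau>) (nhds p)"
    using \<tau>_eq by (simp add: continuous_at tendsto_nhds_iff)
  then have near: "\<forall>\<^sub>F q in nhds p. norm (frechet_derivative \<psi> (at (\<phi> q)) e - \<tau>) < \<epsilon>"
    using \<open>\<epsilon> > 0\<close> by (simp add: tendsto_iff dist_norm)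
  have "\<forall>\<^sub>F q in nhds p. q \<in> W" using W by (intro eventually_nhds_in_open)
  with near show ?thesis
  proof eventually_elim
    case (elim q)
    show ?case
    proof
      assume q: "q \<in> M"
      define c where "c t = \<psi> (\<phi> q + t *\<^sub>R e)" for t
      have line: "((\<lambda>t. \<phi> q + t *\<^sub>R e) has_vector_derivative e) (at 0)"
        by (auto intro!: derivative_eq_intros simp: has_vector_derivative_def)
      have "\<phi> q \<in> V" "\<phi> q \<in> W'" using q elim inv chart by auto
      have "(c has_vector_derivative frechet_derivative \<psi> (at (\<phi> q)) e) (at 0)"
        unfolding c_def by (rule chain[OF line]) (use D\<psi> \<open>\<phi> q \<in> W'\<close> in auto)
      moreover have "c 0 = q" using inv elim by (simp add: c_def)
      moreover have "\<forall>\<^sub>F t in nhds 0. c t \<in> M"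
      proof -
        have "filterlim (\<lambda>t. \<phi> q + t *\<^sub>R e) (nhds (\<phi> q)) (nhds 0)"
          using curve_continuous[OF line] by simp
        then have "\<forall>\<^sub>F t in nhds 0. \<phi> q + t *\<^sub>R e \<in> W'"
          by (rule eventually_compose_filterlim[OF eventually_nhds_in_open[OF W(4) \<open>\<phi> q \<in> W'\<close>]])
        then show ?thesis
        proof eventually_elim
          case (elim t)
          have "\<phi> q + t *\<^sub>R e \<in> V"
            using \<open>\<phi> q \<in> V\<close> \<open>e \<in> V\<close> V by (simp add: subspace_add subspace_scale)
          then have "\<phi> q + t *\<^sub>R e \<in> \<phi> ` (M \<inter> W)" using elim chart by auto
          then show ?case unfolding c_def using inv by auto
        qed
      qed
      ultimately show "\<exists>\<sigma>. curve_velocity M q \<sigma> \<and> norm (\<sigma> - \<tau>) < \<epsilon>"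
        unfolding curve_velocity_def using elim by blast
    qed
  qed
qed

section \<open>Normal vectors and first-order optimality\<close>

lemma curve_velocity_mono: "curve_velocity M q \<sigma> \<Longrightarrow> M \<subseteq> N \<Longrightarrow> curve_velocity N q \<sigma>"
  unfolding curve_velocity_def by (fast elim: eventually_mono)

lemma deficient_iff_left_null:
  fixes A :: "real^'n^'m"
  shows "rank A < CARD('m) \<longleftrightarrow> (\<exists>z. norm z = 1 \<and> z v* A = 0)"
proof -
  have "rank A < CARD('m) \<longleftrightarrow> (\<exists>z. z \<noteq> 0 \<and> z v* A = 0)"
    using matrix_nonfull_linear_equations_eq[of "transpose A"] rank_bound[of A]
    by (auto simp: rank_transpose)
  also have "\<dots> \<longleftrightarrow> (\<exists>z. norm z = 1 \<and> z v* A = 0)"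
  proof
    assume "\<exists>z. z \<noteq> 0 \<and> z v* A = 0"
    then obtain z where "z \<noteq> 0" "z v* A = 0" by auto
    then show "\<exists>z. norm z = 1 \<and> z v* A = 0"
      by (intro exI[of _ "z /\<^sub>R norm z"]) (simp add: scaleR_vector_matrix_assoc)
  next
    assume "\<exists>z. norm z = 1 \<and> z v* A = 0"
    then show "\<exists>z. z \<noteq> 0 \<and> z v* A = 0" by (metis norm_zero zero_neq_one)
  qed
  finally show ?thesis .
qed

text \<open>The left kernel is the orthogonal complement of the column space, hence a line.\<close>

lemma left_null_collinear:
  fixes A :: "real^'n^'m"
  assumes rk: "rank A = CARD('m) - 1" and z0: "z0 v* A = 0" "z0 \<noteq> 0" and z: "z v* A = 0"
  obtains a where "z = a *\<^sub>R z0"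
proof -
  define N where "N = {y :: real^'m. y v* A = 0}"
  have N: "N = {y \<in> UNIV. \<forall>x\<in>range ((*v) A). orthogonal x y}"
  proof -
    have "y v* A = 0 \<longleftrightarrow> (\<forall>x. (A *v x) \<bullet> y = 0)" for y
      by (metis inner_eq_zero_iff inner_zero_left dot_lmul_matrix inner_commute)
    then show ?thesis
      by (auto simp: N_def orthogonal_def)
  qed
  have "dim (range ((*v) A)) + dim N = dim (UNIV :: (real^'m) set)"
    unfolding N
    by (subst add.commute, rule dim_subspace_orthogonal_to_vectors)
      (auto intro!: linear_subspace_image matrix_vector_mul_linear subspace_UNIV)
  then have dN: "dim N \<le> dim {z0}"
    using rk z0(2) by (simp add: rank_dim_range[symmetric] dim_singleton)
  have sN: "subspace N"
    unfolding N_def subspace_def by (auto simp: algebra_simps scaleR_vector_matrix_assoc)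
  have "span {z0} \<subseteq> N"
    by (rule span_minimal[OF _ sN]) (simp add: N_def z0(1))
  then have "span {z0} = N"
    using dN by (intro subspace_dim_equal[OF subspace_span sN]) auto
  then have "z \<in> span {z0}" using z by (auto simp: N_def)
  then show thesis using that by (auto simp: span_singleton)
qed

text \<open>The image of the rank-one matrix \<open>z l\<^sup>T\<close> under the adjoint of \<open>L\<close>. For \<open>z\<close> and \<open>l\<close> in the left and
  right kernels of a matrix \<open>S u\<close> of rank \<open>m - 1\<close> these vectors are orthogonal to all velocities of the
  deficient set at \<open>u\<close>.\<close>

definition normal_vector :: "(real^'k \<Rightarrow> real^'n^'m) \<Rightarrow> real^'m \<Rightarrow> real^'n \<Rightarrow> real^'k" where
  "normal_vector L z l = (\<chi> j. z \<bullet> (L (axis j 1) *v l))"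

lemma inner_normal_vector:
  assumes L: "linear L"
  shows "w \<bullet> normal_vector L z l = z \<bullet> (L w *v l)"
proof -
  define f where "f w = z \<bullet> (L w *v l)" for w
  have f: "linear f"
    unfolding f_def by (intro linearI)
      (auto simp: linear_add[OF L] linear_scale[OF L] algebra_simps scaleR_matrix_vector_assoc[symmetric])
  have "f w = f (\<Sum>j\<in>UNIV. w $ j *\<^sub>R axis j 1)"
    using basis_expansion[of w] by (simp add: scalar_mult_eq_scaleR)
  also have "\<dots> = (\<Sum>j\<in>UNIV. w $ j * f (axis j 1))"
    by (simp add: linear_sum[OF f] linear_scale[OF f])
  finally show ?thesis by (simp add: f_def normal_vector_def inner_vec_def)
qed

lemma bounded_bilinear_normal_vector: "bounded_bilinear (normal_vector L)"
  unfolding bilinear_conv_bounded_bilinear[symmetric] bilinear_def normal_vector_def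
  by (auto intro!: linearI simp: vec_eq_iff algebra_simps)

text \<open>A curve \<open>c\<close> of deficient matrices in the affine space lifts to the curve
  \<open>u + t w + g (c t - S u - t L w)\<close> of deficient parameters, where \<open>g\<close> inverts \<open>L\<close> on its range; its
  velocity is \<open>w\<close>, and the squared distance to \<open>\<theta>\<close> along it is minimal at \<open>t = 0\<close>.\<close>

lemma nearest_point_orthogonal:
  fixes L :: "real^'k \<Rightarrow> real^'n^'m"
  assumes L: "linear L" and S: "\<And>x. S x = L x + c0" and near: "nearest_point S \<theta> u"
    and vel: "curve_velocity ({A. rank A < CARD('m)} \<inter> range S) (S u) (L w)"
  shows "(u - \<theta>) \<bullet> w = 0"
proof -
  obtain g where g: "linear g" "\<And>v. v \<in> range L \<Longrightarrow> L (g v) = v"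
    using linear_exists_right_inverse_on[OF L subspace_UNIV] by blast
  obtain c where c: "(c has_vector_derivative L w) (at 0)" "c 0 = S u"
    "\<forall>\<^sub>F t in nhds 0. c t \<in> {A. rank A < CARD('m)} \<inter> range S"
    using vel unfolding curve_velocity_def by auto
  define d where "d t = u - \<theta> + t *\<^sub>R w + g (c t - S u - t *\<^sub>R L w)" for t
  have "((\<lambda>t. c t - S u - t *\<^sub>R L w) has_derivative (\<lambda>t. 0)) (at 0)"
    using c(1) unfolding has_vector_derivative_def by (auto intro!: derivative_eq_intros)
  then have "((\<lambda>t. g (c t - S u - t *\<^sub>R L w)) has_derivative (\<lambda>t. g 0)) (at 0)"
    by (rule bounded_linear.has_derivative[rotated]) (use g linear_conv_bounded_linear in blast)
  then have d: "(d has_derivative (\<lambda>t. t *\<^sub>R w)) (at 0)"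
    unfolding d_def by (auto intro!: derivative_eq_intros simp: linear_0[OF g(1)])
  have d0: "d 0 = u - \<theta>" using c(2) by (simp add: d_def linear_0[OF g(1)])
  have D: "((\<lambda>t. d t \<bullet> d t) has_derivative (\<lambda>t. (u - \<theta>) \<bullet> (t *\<^sub>R w) + (t *\<^sub>R w) \<bullet> (u - \<theta>))) (at 0)"
    using has_derivative_inner[OF d d] by (simp add: d0)
  have "\<forall>\<^sub>F t in nhds 0. d 0 \<bullet> d 0 \<le> d t \<bullet> d t"
    using c(3)
  proof eventually_elim
    case (elim t)
    then obtain x where x: "c t = S x" by auto
    have "c t - S u - t *\<^sub>R L w = L (x - u - t *\<^sub>R w)"
      by (simp add: x S linear_diff[OF L] linear_scale[OF L])
    then have "L (g (c t - S u - t *\<^sub>R L w)) = c t - S u - t *\<^sub>R L w" using g(2) by auto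
    then have "S (\<theta> + d t) = c t"
      by (simp add: S d_def linear_add[OF L] linear_scale[OF L] linear_diff[OF L])
    then have "\<theta> + d t \<in> deficient_params S" using elim by (auto simp: deficient_params_def)
    then have "\<not> (norm (\<theta> + d t - \<theta>))\<^sup>2 < (norm (u - \<theta>))\<^sup>2"
      using near unfolding nearest_point_def is_arg_min_def by blast
    then show ?case by (simp add: d0 power2_norm_eq_inner)
  qed
  then have "\<forall>\<^sub>F t in at 0. d 0 \<bullet> d 0 \<le> d t \<bullet> d t"
    unfolding eventually_at_filter by eventually_elim auto
  from has_derivative_local_min[OF D this] have "(u - \<theta>) \<bullet> w + w \<bullet> (u - \<theta>) = 0"
    by (auto dest: fun_cong[where x=1])
  then show ?thesis by (simp add: inner_commute)
qed

text \<open>Continuity of kernels, applied to the transpose; \<open>sgn\<close> normalises the null vector and is continuous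
  at the unit vector \<open>z0\<close>.\<close>

lemma eventually_left_null_near:
  fixes A :: "real^'n^'m"
  assumes z0: "z0 v* A = 0" "norm z0 = 1" and P: "eventually P (nhds z0)"
  shows "\<forall>\<^sub>F B in nhds A. rank B \<le> rank A \<longrightarrow> (\<exists>z. norm z = 1 \<and> z v* B = 0 \<and> P z)"
proof -
  have "isCont sgn z0" using z0 by (intro continuous_intros) auto
  moreover have "sgn z0 = z0" using z0 by (simp add: sgn_div_norm)
  ultimately have "filterlim sgn (nhds z0) (nhds z0)"
    by (simp add: continuous_at tendsto_nhds_iff)
  then have "\<forall>\<^sub>F y in nhds z0. P (sgn y)" using P by (rule eventually_compose_filterlim[rotated])
  moreover have "\<forall>\<^sub>F y in nhds z0. y \<noteq> 0"
    using z0 by (intro t1_space_nhds) auto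
  ultimately have "\<forall>\<^sub>F y in nhds z0. P (sgn y) \<and> y \<noteq> 0" by eventually_elim auto
  then obtain \<delta> where \<delta>: "\<delta> > 0" "\<And>y. norm (y - z0) < \<delta> \<Longrightarrow> P (sgn y) \<and> y \<noteq> 0"
    by (auto simp: eventually_nhds_metric dist_norm)
  have "\<forall>\<^sub>F B in nhds (transpose A). rank B \<le> rank (transpose A) \<longrightarrow>
      (\<exists>y. B *v y = 0 \<and> norm (y - z0) < \<delta>)"
    by (rule eventually_kernel_near) (use z0 \<delta> in auto)
  moreover have "filterlim transpose (nhds (transpose A)) (nhds A)"
  proof -
    have "linear (transpose :: real^'n^'m \<Rightarrow> _)"
      by (intro linearI) (auto simp: transpose_def vec_eq_iff)
    then have "isCont transpose A" by (simp add: linear_continuous_at linear_conv_bounded_linear)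
    then show ?thesis by (simp add: continuous_at tendsto_nhds_iff)
  qed
  ultimately have "\<forall>\<^sub>F B in nhds A. rank (transpose B) \<le> rank (transpose A) \<longrightarrow>
      (\<exists>y. transpose B *v y = 0 \<and> norm (y - z0) < \<delta>)"
    by (rule eventually_compose_filterlim)
  then show ?thesis
  proof eventually_elim
    case (elim B)
    show ?case
    proof
      assume "rank B \<le> rank A"
      with elim obtain y where y: "y v* B = 0" "norm (y - z0) < \<delta>"
        by (auto simp: rank_transpose)
      then have "norm (sgn y) = 1 \<and> sgn y v* B = 0 \<and> P (sgn y)"
        using \<delta>(2)[OF y(2)] by (auto simp: norm_sgn sgn_div_norm scaleR_vector_matrix_assoc)
      then show "\<exists>z. norm z = 1 \<and> z v* B = 0 \<and> P z" by blast
    qed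
  qed
qed

section \<open>Residuals of nearest points are small normal vectors\<close>

text \<open>The tangent space of the affine space is its direction space, and that of the constant-rank
  matrices is cut out by the kernels; so non-tangentiality identifies the velocities of the
  intersection with the orthogonal complement of the normal vectors \<open>normal_vector L z0 l\<close>.\<close>

lemma nontangential_splitting:
  fixes L :: "real^'k \<Rightarrow> real^'n^'m"
  assumes L: "linear L" and S: "\<And>x. S x = L x + c0"
    and meet: "meet_nontangentially {A. rank A = CARD('m) - 1} (range S) (S p)"
    and z0: "z0 v* S p = 0" "z0 \<noteq> 0"
  obtains h l where "b = h + normal_vector L z0 l" "S p *v l = 0"
    "L h \<in> tangent_space (S p) ({A. rank A = CARD('m) - 1} \<inter> range S)"
proof -
  have rk: "rank (S p) = CARD('m) - 1"
    and tan: "tangent_space (S p) ({A. rank A = CARD('m) - 1} \<inter> range S) =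
      tangent_space (S p) {A. rank A = CARD('m) - 1} \<inter> tangent_space (S p) (range S)"
    using meet unfolding meet_nontangentially_def by auto
  interpret nv: bounded_bilinear "normal_vector L" by (rule bounded_bilinear_normal_vector)
  define G where "G = normal_vector L z0 ` {l. S p *v l = 0}"
  have "subspace G"
    unfolding G_def
    by (intro linear_subspace_image bounded_linear.linear nv.bounded_linear_right)
      (auto simp: subspace_def algebra_simps)
  then have G: "span G = G" by simp
  obtain y h where yh: "y \<in> span G" "\<And>w. w \<in> span G \<Longrightarrow> orthogonal h w" "b = y + h"
    using orthogonal_subspace_decomp_exists by blast
  then obtain l where l: "y = normal_vector L z0 l" "S p *v l = 0" unfolding G by (auto simp: G_def)
  have orth: "z0 \<bullet> (L h *v x) = 0" if "S p *v x = 0" for x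
  proof -
    have "normal_vector L z0 x \<in> span G" using that unfolding G by (auto simp: G_def)
    then have "h \<bullet> normal_vector L z0 x = 0" using yh(2) by (simp add: orthogonal_def)
    then show ?thesis by (simp add: inner_normal_vector[OF L])
  qed
  have "z \<bullet> (L h *v x) = 0" if zx: "z v* S p = 0" "S p *v x = 0" for z x
  proof -
    obtain a where "z = a *\<^sub>R z0" using left_null_collinear[OF rk z0 zx(1)] .
    then show ?thesis using orth[OF zx(2)] by simp
  qed
  then have "L h \<in> tangent_space (S p) {B. rank B = rank (S p)}"
    by (rule tangent_space_constant_rank)
  moreover have "L h \<in> tangent_space (S p) (range S)"
  proof -
    define c where "c t = S p + t *\<^sub>R L h + t\<^sup>2 *\<^sub>R 0" for t :: real
    have "c t = S (p + t *\<^sub>R h)" for t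
      by (simp add: c_def S linear_add[OF L] linear_scale[OF L])
    then have "range c \<subseteq> range S" by auto
    moreover have "(c has_vector_derivative L h) (at 0)"
      unfolding c_def has_vector_derivative_def by (auto intro!: derivative_eq_intros)
    moreover have "smooth_on {-1<..<1} c"
      unfolding smooth_on_def c_def using Ck_on_quadratic by blast
    moreover have "c 0 = S p" by (simp add: c_def)
    ultimately show ?thesis
      unfolding tangent_space_def mem_Collect_eq by (intro exI[of _ c] exI[of _ 1]) auto
  qed
  ultimately have "L h \<in> tangent_space (S p) ({A. rank A = CARD('m) - 1} \<inter> range S)"
    using rk tan by simp
  then show thesis using that[of h l] yh(3) l by (simp add: add.commute)
qed

lemma sum_abs_component_le: "(\<Sum>i\<in>UNIV. \<bar>w $ i\<bar> * B i) \<le> norm w * (\<Sum>i\<in>UNIV. B i)"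
  if "\<And>i. B i \<ge> 0" for w :: "real^'k"
  unfolding sum_distrib_left
  by (intro sum_mono mult_right_mono component_le_norm_cart that)

text \<open>The splitting at \<open>p\<close> of each coordinate vector into a velocity and a normal vector persists,
  approximately, at a nearby \<open>u\<close>. The perturbed coordinate vectors still span the whole space,
  velocities and normal vectors at \<open>u\<close> are orthogonal, and so the residual \<open>u - \<theta>\<close>, being orthogonal
  to all velocities, is a normal vector; its multiplier is bounded by the residual because the
  perturbed basis is uniformly well conditioned.\<close>

lemma residual_is_normal:
  fixes L :: "real^'k \<Rightarrow> real^'n^'m"
  assumes L: "linear L" and S: "\<And>x. S x = L x + c0"
    and meet: "meet_nontangentially {A. rank A = CARD('m) - 1} (range S) (S p)"
    and z0: "z0 v* S p = 0" "norm z0 = 1"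
  obtains C where "\<And>\<epsilon>. \<epsilon> > 0 \<Longrightarrow> \<forall>\<^sub>F u in nhds p. u \<in> deficient_params S \<longrightarrow>
    (\<forall>\<theta>. nearest_point S \<theta> u \<longrightarrow>
      (\<exists>z l. norm z = 1 \<and> norm (z - z0) < \<epsilon> \<and> z v* S u = 0 \<and> S u *v l = 0 \<and>
        u - \<theta> = normal_vector L z l \<and> norm l \<le> C * norm (u - \<theta>)))"
proof -
  interpret nv: bounded_bilinear "normal_vector L" by (rule bounded_bilinear_normal_vector)
  define M where "M = {A :: real^'n^'m. rank A = CARD('m) - 1} \<inter> range S"
  have rk: "rank (S p) = CARD('m) - 1" and M: "smooth_manifold_near M (S p)"
    using meet unfolding meet_nontangentially_def M_def by auto
  have m_pos: "CARD('m) > 0" by simp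
  have "\<forall>i. \<exists>h l. axis i 1 = h + normal_vector L z0 l \<and> S p *v l = 0 \<and> L h \<in> tangent_space (S p) M"
    using nontangential_splitting[OF L S meet z0(1)] z0(2) unfolding M_def
    by (metis norm_zero zero_neq_one)
  then obtain h l where split: "\<And>i. axis i 1 = h i + normal_vector L z0 (l i)"
    and l: "\<And>i. S p *v l i = 0" and h: "\<And>i. L (h i) \<in> tangent_space (S p) M"
    by metis
  \<comment> \<open>Each of the two parts of a perturbed coordinate vector may be off by \<open>e\<close>; summed over \<open>CARD('k)\<close>
      coordinates, the perturbation of the identity is at most \<open>1/2\<close>.\<close>
  define e where "e = 1 / (4 * real CARD('k))"
  have e: "e > 0" "real CARD('k) * (2 * e) \<le> 1 / 2" by (auto simp: e_def)
  define C where "C = 2 * (\<Sum>i\<in>UNIV. norm (l i) + 1)"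
  obtain g where g: "linear g" "\<And>v. v \<in> range L \<Longrightarrow> L (g v) = v"
    using linear_exists_right_inverse_on[OF L subspace_UNIV] by blast
  have "bounded_linear g" using g(1) by (simp add: linear_conv_bounded_linear)
  then obtain K where K: "K > 0" "\<And>x. norm (g x) \<le> norm x * K"
    using bounded_linear.pos_bounded by blast
  have contS: "filterlim S (nhds (S p)) (nhds p)"
  proof -
    have "isCont S p"
      unfolding S using L by (intro continuous_intros) (simp_all add: linear_continuous_at linear_conv_bounded_linear)
    then show ?thesis by (simp add: continuous_at tendsto_nhds_iff)
  qed
  have rkM: "\<forall>\<^sub>F u in nhds p. u \<in> deficient_params S \<longrightarrow> S u \<in> M"
    using eventually_compose_filterlim[OF eventually_rank_ge contS]
    by eventually_elim (auto simp: M_def deficient_params_def rk)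
  have vel: "\<forall>\<^sub>F u in nhds p. S u \<in> M \<longrightarrow> (\<exists>h'. curve_velocity M (S u) (L h') \<and> norm (h' - h i) < e)" for i
  proof -
    have "\<forall>\<^sub>F A in nhds (S p). A \<in> M \<longrightarrow> (\<exists>\<sigma>. curve_velocity M A \<sigma> \<and> norm (\<sigma> - L (h i)) < e / K)"
      using e K by (intro smooth_manifold_velocities_near M h) auto
    from eventually_compose_filterlim[OF this contS] show ?thesis
    proof eventually_elim
      case (elim u)
      show ?case
      proof
        assume "S u \<in> M"
        with elim obtain \<sigma> where \<sigma>: "curve_velocity M (S u) \<sigma>" "norm (\<sigma> - L (h i)) < e / K" by auto
        have "\<sigma> \<in> range L"
        proof -
          obtain c where c: "(c has_vector_derivative \<sigma>) (at 0)" "c 0 = S u" "\<forall>\<^sub>F t in nhds 0. c t \<in> M"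
            using \<sigma>(1) unfolding curve_velocity_def by auto
          have "subspace (range L)" by (intro linear_subspace_image L subspace_UNIV)
          with c(1) show ?thesis
          proof (rule velocity_in_subspace)
            show "\<forall>\<^sub>F t in nhds 0. c t - c 0 \<in> range L"
              using c(3)
            proof eventually_elim
              case (elim t)
              then obtain x where "c t = S x" by (auto simp: M_def)
              then have "c t - c 0 = L (x - u)" by (simp add: c(2) S linear_diff[OF L])
              then show ?case by auto
            qed
          qed
        qed
        then have "\<sigma> - L (h i) \<in> range L" by (metis (no_types) L imageE linear_diff rangeI)
        then have "L (h i + g (\<sigma> - L (h i))) = \<sigma>" by (simp add: linear_add[OF L] g(2))
        moreover have "norm (g (\<sigma> - L (h i))) < e"
          using K(2)[of "\<sigma> - L (h i)"] \<sigma>(2) K(1) by (simp add: field_simps)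
        ultimately show "\<exists>h'. curve_velocity M (S u) (L h') \<and> norm (h' - h i) < e"
          using \<sigma>(1) by (intro exI[of _ "h i + g (\<sigma> - L (h i))"]) auto
      qed
    qed
  qed
  have "\<exists>P Q. eventually P (nhds z0) \<and> eventually Q (nhds (l i)) \<and>
      (\<forall>z x. P z \<longrightarrow> Q x \<longrightarrow> norm (normal_vector L z x - normal_vector L z0 (l i)) < e)" for i
  proof -
    have "((\<lambda>q. normal_vector L (fst q) (snd q)) \<longlongrightarrow> normal_vector L z0 (l i)) (nhds z0 \<times>\<^sub>F nhds (l i))"
      by (intro nv.tendsto filterlim_fst filterlim_snd)
    then have "\<forall>\<^sub>F q in nhds z0 \<times>\<^sub>F nhds (l i).
        norm (normal_vector L (fst q) (snd q) - normal_vector L z0 (l i)) < e"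
      using e(1) by (simp add: tendsto_iff dist_norm)
    then show ?thesis unfolding eventually_prod_filter by (auto simp: dist_norm)
  qed
  then obtain P Q where PQ: "\<And>i. eventually (P i) (nhds z0)" "\<And>i. eventually (Q i) (nhds (l i))"
    "\<And>i z x. P i z \<Longrightarrow> Q i x \<Longrightarrow> norm (normal_vector L z x - normal_vector L z0 (l i)) < e"
    by metis
  have ker: "\<forall>\<^sub>F u in nhds p. S u \<in> M \<longrightarrow> (\<exists>x. S u *v x = 0 \<and> Q i x \<and> norm x \<le> norm (l i) + 1)" for i
  proof -
    obtain \<delta> where \<delta>: "\<delta> > 0" "\<And>x. norm (x - l i) < \<delta> \<Longrightarrow> Q i x"
      using PQ(2)[of i] by (auto simp: eventually_nhds_metric dist_norm)
    have "\<forall>\<^sub>F A in nhds (S p). rank A \<le> rank (S p) \<longrightarrow> (\<exists>x. A *v x = 0 \<and> norm (x - l i) < min \<delta> 1)"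
      using \<delta> l by (intro eventually_kernel_near) auto
    from eventually_compose_filterlim[OF this contS] show ?thesis
    proof eventually_elim
      case (elim u)
      show ?case
      proof
        assume "S u \<in> M"
        with elim obtain x where x: "S u *v x = 0" "norm (x - l i) < min \<delta> 1"
          by (auto simp: M_def rk)
        moreover have "norm x \<le> norm (l i) + 1"
          using norm_triangle_ineq[of "x - l i" "l i"] x(2) by simp
        ultimately show "\<exists>x. S u *v x = 0 \<and> Q i x \<and> norm x \<le> norm (l i) + 1"
          using \<delta>(2) by auto
      qed
    qed
  qed
  have main: "\<forall>\<^sub>F u in nhds p. u \<in> deficient_params S \<longrightarrow>
    (\<forall>\<theta>. nearest_point S \<theta> u \<longrightarrow>
      (\<exists>z l. norm z = 1 \<and> norm (z - z0) < \<epsilon> \<and> z v* S u = 0 \<and> S u *v l = 0 \<and>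
        u - \<theta> = normal_vector L z l \<and> norm l \<le> C * norm (u - \<theta>)))" if "\<epsilon> > 0" for \<epsilon>
  proof -
    have "\<forall>\<^sub>F z in nhds z0. norm (z - z0) < \<epsilon>"
      using \<open>\<epsilon> > 0\<close> by (auto simp: eventually_nhds_metric dist_norm)
    moreover have "\<forall>\<^sub>F z in nhds z0. \<forall>i. P i z"
      using PQ(1) by (intro eventually_all_finite) auto
    ultimately have "\<forall>\<^sub>F z in nhds z0. norm (z - z0) < \<epsilon> \<and> (\<forall>i. P i z)" by eventually_elim auto
    from eventually_compose_filterlim[OF eventually_left_null_near[OF z0 this] contS]
    have left: "\<forall>\<^sub>F u in nhds p. rank (S u) \<le> rank (S p) \<longrightarrow>
      (\<exists>z. norm z = 1 \<and> z v* S u = 0 \<and> norm (z - z0) < \<epsilon> \<and> (\<forall>i. P i z))" .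
    have "\<forall>\<^sub>F u in nhds p. \<forall>i. S u \<in> M \<longrightarrow> (\<exists>h'. curve_velocity M (S u) (L h') \<and> norm (h' - h i) < e)"
      using vel by (intro eventually_all_finite) auto
    moreover have "\<forall>\<^sub>F u in nhds p. \<forall>i. S u \<in> M \<longrightarrow>
        (\<exists>x. S u *v x = 0 \<and> Q i x \<and> norm x \<le> norm (l i) + 1)"
      using ker by (intro eventually_all_finite) auto
    ultimately show ?thesis
      using left rkM
    proof eventually_elim
      case (elim u)
      show ?case
      proof (intro impI allI)
        fix \<theta> assume "u \<in> deficient_params S" and near: "nearest_point S \<theta> u"
        then have uM: "S u \<in> M" using elim by auto
        then have rku: "rank (S u) = rank (S p)" by (auto simp: M_def rk)
        obtain h' where h': "\<And>i. curve_velocity M (S u) (L (h' i))" "\<And>i. norm (h' i - h i) < e"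
          using elim(1) uM by metis
        obtain x where x: "\<And>i. S u *v x i = 0" "\<And>i. Q i (x i)" "\<And>i. norm (x i) \<le> norm (l i) + 1"
          using elim(2) uM by metis
        obtain z where z: "norm z = 1" "z v* S u = 0" "norm (z - z0) < \<epsilon>" "\<And>i. P i z"
          using elim(3) rku by auto
        define v where "v = u - \<theta>"
        have v_orth: "v \<bullet> h' i = 0" for i
          unfolding v_def
          by (rule nearest_point_orthogonal[OF L S near], rule curve_velocity_mono[OF h'(1)])
            (auto simp: M_def m_pos)
        have nv_orth: "normal_vector L z y \<bullet> h' i = 0" if "S u *v y = 0" for i y
        proof -
          have "curve_velocity {B. rank B \<le> rank (S u)} (S u) (L (h' i))"
            by (rule curve_velocity_mono[OF h'(1)]) (auto simp: M_def rku rk)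
          from constant_rank_velocity[OF this z(2) that]
          show ?thesis by (simp add: inner_commute inner_normal_vector[OF L])
        qed
        \<comment> \<open>\<open>T\<close> sends the coordinate basis to the perturbed one. Expanding \<open>v = T w\<close> splits \<open>v\<close> into a
            velocity \<open>hh\<close> and a normal vector, and orthogonality forces \<open>hh = 0\<close>.\<close>
        define T where "T w = (\<Sum>i\<in>UNIV. w $ i *\<^sub>R (h' i + normal_vector L z (x i)))" for w
        have T: "linear T"
          unfolding T_def by (intro linearI) (auto simp: algebra_simps sum.distrib scaleR_sum_right)
        have near_id: "norm (T w - w) \<le> 1 / 2 * norm w" for w
        proof -
          have dev: "norm (h' i + normal_vector L z (x i) - axis i 1) \<le> 2 * e" for i
          proof -
            have "h' i + normal_vector L z (x i) - axis i 1 =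
                (h' i - h i) + (normal_vector L z (x i) - normal_vector L z0 (l i))"
              by (simp add: split)
            also have "norm \<dots> \<le> norm (h' i - h i) + norm (normal_vector L z (x i) - normal_vector L z0 (l i))"
              by (rule norm_triangle_ineq)
            also have "\<dots> \<le> 2 * e" using h'(2)[of i] PQ(3)[OF z(4) x(2), of i] by simp
            finally show ?thesis .
          qed
          have "w = (\<Sum>i\<in>UNIV. w $ i *\<^sub>R axis i 1)"
            using basis_expansion[of w] by (simp add: scalar_mult_eq_scaleR)
          then have "T w - w = (\<Sum>i\<in>UNIV. w $ i *\<^sub>R (h' i + normal_vector L z (x i) - axis i 1))"
            by (simp add: T_def sum_subtractf scaleR_diff_right)
          also have "norm \<dots> \<le> (\<Sum>i\<in>UNIV. \<bar>w $ i\<bar> * (2 * e))"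
            by (rule order_trans[OF norm_sum sum_mono]) (use dev in \<open>auto intro!: mult_left_mono\<close>)
          also have "\<dots> \<le> norm w * (\<Sum>i\<in>(UNIV::'k set). 2 * e)"
            by (rule sum_abs_component_le) (use e in auto)
          also have "\<dots> \<le> norm w * (1 / 2)" using e(2) by (intro mult_left_mono) auto
          finally show ?thesis by simp
        qed
        obtain w where w: "T w = v" "norm w \<le> 2 * norm v"
          using near_identity_solve[OF T near_id] by auto
        define y where "y = (\<Sum>i\<in>UNIV. w $ i *\<^sub>R x i)"
        define hh where "hh = (\<Sum>i\<in>UNIV. w $ i *\<^sub>R h' i)"
        have Sy: "S u *v y = 0"
          unfolding y_def by (simp add: linear_sum[OF matrix_vector_mul_linear] matrix_vector_mult_scaleR x(1))
        have v: "v = hh + normal_vector L z y"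
          unfolding w(1)[symmetric] T_def hh_def y_def
          by (simp add: scaleR_add_right sum.distrib nv.sum_right nv.scaleR_right)
        have "v \<bullet> hh = 0" "normal_vector L z y \<bullet> hh = 0"
          unfolding hh_def by (simp_all add: inner_sum_right v_orth nv_orth[OF Sy])
        then have "hh \<bullet> hh = 0" using v by (simp add: inner_add_left)
        then have v': "v = normal_vector L z y" using v by simp
        have "norm y \<le> (\<Sum>i\<in>UNIV. \<bar>w $ i\<bar> * (norm (l i) + 1))"
          unfolding y_def
          by (rule order_trans[OF norm_sum sum_mono]) (use x(3) in \<open>auto intro!: mult_left_mono\<close>)
        also have "\<dots> \<le> norm w * (\<Sum>i\<in>UNIV. norm (l i) + 1)"
          by (rule sum_abs_component_le) auto
        also have "\<dots> \<le> (2 * norm v) * (\<Sum>i\<in>UNIV. norm (l i) + 1)"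
          using w(2) by (intro mult_right_mono sum_nonneg) auto
        also have "\<dots> = C * norm v" by (simp add: C_def)
        finally have "norm y \<le> C * norm v" .
        with z Sy v' show "\<exists>z l. norm z = 1 \<and> norm (z - z0) < \<epsilon> \<and> z v* S u = 0 \<and> S u *v l = 0 \<and>
            u - \<theta> = normal_vector L z l \<and> norm l \<le> C * norm (u - \<theta>)"
          unfolding v_def[symmetric] by blast
      qed
    qed
  qed
  show thesis by (rule that) (rule main)
qed

section \<open>Inner products of block matrices\<close>

lemma sum_option: "(\<Sum>p\<in>UNIV. f p) = f None + (\<Sum>j\<in>UNIV. f (Some j))"
  for f :: "'k::finite option \<Rightarrow> 'a::comm_monoid_add"
  by (simp add: UNIV_option_conv sum.reindex)

lemma sum_blocks: "(\<Sum>I\<in>UNIV. f I) = (\<Sum>\<alpha>\<in>UNIV. f (None, \<alpha>)) + (\<Sum>j\<in>UNIV. \<Sum>\<alpha>\<in>UNIV. f (Some j, \<alpha>))"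
  for f :: "'k::finite option \<times> 'm::finite \<Rightarrow> 'a::comm_monoid_add"
proof -
  have "(\<Sum>I\<in>UNIV. f I) = (\<Sum>p\<in>UNIV. \<Sum>\<alpha>\<in>UNIV. f (p, \<alpha>))"
    by (simp add: sum.cartesian_product)
  then show ?thesis by (simp add: sum_option)
qed

text \<open>Against a symmetric matrix the trace product is the Euclidean inner product of matrices, for which
  transpositions can be moved across.\<close>

lemma mat_inner_symmetric: "transpose X = X \<Longrightarrow> C \<bullet>\<^sub>M X = C \<bullet> X" for X :: "real^'i^'i"
  by (simp add: mat_inner_def trace_def matrix_matrix_mult_def inner_vec_def transpose_def vec_eq_iff)

lemma inner_outer: "outer x y \<bullet> X = x \<bullet> (X *v y)" for X :: "real^'i^'j"
  by (simp add: outer_def inner_vec_def matrix_vector_mult_def sum_distrib_left mult_ac)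

lemma outer_mult_vec: "outer x y *v w = (y \<bullet> w) *\<^sub>R x"
  by (simp add: outer_def inner_vec_def matrix_vector_mult_def vec_eq_iff sum_distrib_left mult_ac)

lemma transpose_outer: "transpose (outer x y) = outer y x"
  by (simp add: outer_def transpose_def vec_eq_iff)

lemma outer_scaleR: "outer (c *\<^sub>R x) (c *\<^sub>R x) = c\<^sup>2 *\<^sub>R outer x x"
  by (simp add: outer_def vec_eq_iff power2_eq_square)

lemma transpose_add: "transpose (A + B) = transpose A + transpose B" for A :: "'a::plus^'i^'j"
  by (simp add: transpose_def vec_eq_iff)

lemma transpose_sum: "transpose (\<Sum>i\<in>I. A i) = (\<Sum>i\<in>I. transpose (A i))" for A :: "_ \<Rightarrow> real^'i^'j"
  by (induction I rule: infinite_finite_induct) (simp_all add: transpose_add, simp_all add: transpose_def vec_eq_iff)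

lemma inner_transpose: "transpose C \<bullet> X = C \<bullet> transpose X" for X :: "real^'i^'i"
  unfolding inner_vec_def transpose_def by (simp, rule sum.swap)

lemma inner_block_transpose: "block_transpose C \<bullet> X = C \<bullet> block_transpose X"
proof -
  have "block_transpose C \<bullet> X = (\<Sum>(I, J)\<in>UNIV \<times> UNIV. C $ (fst I, snd J) $ (fst J, snd I) * X $ I $ J)"
    unfolding sum.cartesian_product[symmetric] by (simp add: inner_vec_def block_transpose_def)
  also have "\<dots> = (\<Sum>(I, J)\<in>UNIV \<times> UNIV. C $ I $ J * X $ (fst I, snd J) $ (fst J, snd I))"
    by (rule sum.reindex_bij_witness[of _ "\<lambda>(I, J). ((fst I, snd J), (fst J, snd I))"
        "\<lambda>(I, J). ((fst I, snd J), (fst J, snd I))"]) auto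
  also have "\<dots> = C \<bullet> block_transpose X"
    unfolding sum.cartesian_product[symmetric] by (simp add: inner_vec_def block_transpose_def)
  finally show ?thesis .
qed

text \<open>\<open>bSym\<close> is the orthogonal projection onto the block-symmetric matrices.\<close>

lemma inner_bSym: "X \<in> block_symmetric \<Longrightarrow> bSym M \<bullet> X = M \<bullet> X"
  by (simp add: bSym_def block_symmetric_def Let_def inner_block_transpose inner_transpose inner_add_left)

lemma symmetric_inner: "transpose X = X \<Longrightarrow> x \<bullet> (X *v y) = y \<bullet> (X *v x)" for X :: "real^'i^'i"
  by (metis dot_lmul_matrix inner_commute transpose_matrix_vector)

section \<open>Positive semidefinite matrices\<close>

text \<open>Otherwise a small step from \<open>x\<close> against the gradient \<open>X x\<close> would make the form negative.\<close>

lemma psd_null: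
  fixes X :: "real^'i^'i"
  assumes X: "psd X" and x: "x \<bullet> (X *v x) = 0"
  shows "X *v x = 0"
proof (rule ccontr)
  let ?w = "X *v x"
  assume ne: "?w \<noteq> 0"
  define q where "q = ?w \<bullet> (X *v ?w)"
  have "0 \<le> (x - t *\<^sub>R ?w) \<bullet> (X *v (x - t *\<^sub>R ?w))" for t using X by (simp add: psd_def)
  moreover have "(x - t *\<^sub>R ?w) \<bullet> (X *v (x - t *\<^sub>R ?w)) = t * (t * q - 2 * (?w \<bullet> ?w))" for t
    using x symmetric_inner[of X x ?w] X
    by (simp add: psd_def q_def algebra_simps inner_diff_left inner_diff_right)
  ultimately have ge: "0 \<le> t * (t * q - 2 * (?w \<bullet> ?w))" for t by simp
  \<comment> \<open>A positive step with \<open>t q \<le> ?w \<bullet> ?w\<close>, whatever the sign of the curvature \<open>q\<close>.\<close>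
  define t where "t = (?w \<bullet> ?w) / (\<bar>q\<bar> + 1)"
  have w: "?w \<bullet> ?w > 0" using ne by simp
  then have t: "t > 0" by (simp add: t_def add_nonneg_pos)
  have "t * q \<le> t * (\<bar>q\<bar> + 1)" using t by (intro mult_left_mono) auto
  also have "\<dots> = ?w \<bullet> ?w" by (simp add: t_def add_nonneg_pos)
  finally have "t * q - 2 * (?w \<bullet> ?w) < 0" using w by linarith
  then have "t * (t * q - 2 * (?w \<bullet> ?w)) < 0" using t by (rule mult_pos_neg[rotated])
  with ge[of t] show False by simp
qed

text \<open>Cholesky factorisation, by clearing one row and column at a time with a Schur complement.\<close>

lemma psd_sum_outer_on:
  fixes X :: "real^'i^'i"
  assumes "finite A" "psd X" "\<And>a b. a \<notin> A \<Longrightarrow> X $ a $ b = 0"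
  shows "\<exists>f. X = (\<Sum>a\<in>A. outer (f a) (f a))"
  using assms
proof (induction A arbitrary: X rule: finite_induct)
  case empty
  then show ?case by (simp add: vec_eq_iff)
next
  case (insert a A)
  have sym: "transpose X = X" and pos: "\<And>x. 0 \<le> x \<bullet> (X *v x)" using insert.prems by (auto simp: psd_def)
  have symc: "X $ b $ c = X $ c $ b" for b c
    using arg_cong[OF sym, of "\<lambda>Y. Y $ c $ b"] by (simp add: transpose_def)
  define w where "w = X *v axis a 1"
  have wc: "w $ b = X $ b $ a" for b
    by (simp add: w_def matrix_vector_mult_basis column_def)
  have aa: "axis a 1 \<bullet> w = X $ a $ a" by (simp add: inner_axis' wc)
  show ?case
  proof (cases "X $ a $ a = 0")
    case True
    then have "w = 0" using psd_null[OF insert.prems(1), of "axis a 1"] aa by (simp add: w_def)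
    then have "X $ a $ b = 0" for b using wc[of b] symc[of a b] by simp
    then have "X $ c $ b = 0" if "c \<notin> A" for b c
      using insert.prems(2)[of c b] that by (cases "c = a") auto
    then obtain f where f: "X = (\<Sum>b\<in>A. outer (f b) (f b))"
      using insert.IH insert.prems(1) by blast
    have "(\<Sum>b\<in>insert a A. outer ((f(a := 0)) b) ((f(a := 0)) b)) = (\<Sum>b\<in>A. outer (f b) (f b))"
      using insert.hyps by (auto simp: outer_def vec_eq_iff intro!: sum.cong)
    then show ?thesis using f by metis
  next
    case False
    define \<alpha> where "\<alpha> = X $ a $ a"
    have \<alpha>: "\<alpha> > 0" using pos[of "axis a 1"] False aa by (simp add: w_def \<alpha>_def)
    define g where "g = (1 / sqrt \<alpha>) *\<^sub>R w"
    have gg: "outer g g = (1 / \<alpha>) *\<^sub>R outer w w"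
      unfolding g_def outer_scaleR using \<alpha> by (simp add: power_divide)
    define Y where "Y = X - outer g g"
    have Yc: "Y $ b $ c = X $ b $ c - X $ b $ a * X $ c $ a / \<alpha>" for b c
      unfolding Y_def gg by (simp add: outer_def wc)
    have "psd Y"
      unfolding psd_def
    proof (intro conjI allI)
      show "transpose Y = Y" by (simp add: vec_eq_iff transpose_def Yc symc mult.commute)
      fix y
      define r where "r = (w \<bullet> y) / \<alpha>"
      have e1: "axis a 1 \<bullet> (X *v y) = w \<bullet> y"
        using symmetric_inner[OF sym, of "axis a 1" y] by (simp add: w_def inner_commute)
      have "y \<bullet> (Y *v y) = y \<bullet> (X *v y) - (w \<bullet> y)\<^sup>2 / \<alpha>"
        by (simp add: Y_def gg algebra_simps inner_diff_right scaleR_matrix_vector_assoc[symmetric]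
            outer_mult_vec inner_commute power2_eq_square)
      also have "\<dots> = (y - r *\<^sub>R axis a 1) \<bullet> (X *v (y - r *\<^sub>R axis a 1))"
        using \<alpha> e1 aa
        by (simp add: algebra_simps inner_diff_left inner_diff_right w_def[symmetric] \<alpha>_def[symmetric]
            inner_commute r_def power2_eq_square)
      also have "\<dots> \<ge> 0" by (rule pos)
      finally show "0 \<le> y \<bullet> (Y *v y)" .
    qed
    moreover have "Y $ c $ b = 0" if "c \<notin> A" for b c
    proof (cases "c = a")
      case True
      then show ?thesis using \<alpha> by (simp add: Yc \<alpha>_def[symmetric] symc[of b a])
    next
      case False
      then show ?thesis using insert.prems(2)[of c] that by (simp add: Yc)
    qed
    ultimately obtain f where f: "Y = (\<Sum>b\<in>A. outer (f b) (f b))"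
      using insert.IH by blast
    have "(\<Sum>b\<in>insert a A. outer ((f(a := g)) b) ((f(a := g)) b)) = outer g g + (\<Sum>b\<in>A. outer (f b) (f b))"
      using insert.hyps by (auto intro!: sum.cong)
    also have "\<dots> = X" by (simp add: f[symmetric] Y_def)
    finally show ?thesis by metis
  qed
qed

lemma psd_sum_outer:
  fixes X :: "real^'i^'i"
  assumes "psd X"
  obtains f :: "'i \<Rightarrow> real^'i" where "X = (\<Sum>a\<in>UNIV. outer (f a) (f a))"
  using psd_sum_outer_on[of UNIV X] assms by auto

lemma psd_inner_nonneg:
  fixes X Q :: "real^'i^'i"
  assumes "psd Q" "psd X"
  shows "0 \<le> Q \<bullet> X"
proof -
  obtain f :: "'i \<Rightarrow> real^'i" where "X = (\<Sum>a\<in>UNIV. outer (f a) (f a))"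
    using psd_sum_outer[OF assms(2)] .
  then have "Q \<bullet> X = (\<Sum>a\<in>UNIV. f a \<bullet> (Q *v f a))"
    by (simp add: inner_sum_right inner_commute[of Q] inner_outer)
  then show ?thesis using assms(1) by (simp add: psd_def sum_nonneg)
qed

text \<open>Each vector of a Cholesky factorisation of \<open>X\<close> must be a null vector of \<open>Q\<close>.\<close>

lemma psd_complementary_rank_one:
  fixes X Q :: "real^'i^'i"
  assumes Q: "psd Q" and X: "psd X" and "Q \<bullet> X = 0"
    and ker: "\<And>y. Q *v y = 0 \<Longrightarrow> \<exists>c. y = c *\<^sub>R x"
  obtains s where "X = s *\<^sub>R outer x x"
proof -
  obtain f :: "'i \<Rightarrow> real^'i" where f: "X = (\<Sum>a\<in>UNIV. outer (f a) (f a))"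
    using psd_sum_outer[OF X] .
  then have "(\<Sum>a\<in>UNIV. f a \<bullet> (Q *v f a)) = 0"
    using assms(3) by (simp add: inner_sum_right inner_commute[of Q] inner_outer)
  then have "f a \<bullet> (Q *v f a) = 0" for a
    using Q by (subst (asm) sum_nonneg_eq_0_iff) (auto simp: psd_def)
  then have "\<exists>c. f a = c *\<^sub>R x" for a using psd_null[OF Q] ker by blast
  then obtain c where "\<And>a. f a = c a *\<^sub>R x" by metis
  then have "X = (\<Sum>a\<in>UNIV. (c a)\<^sup>2) *\<^sub>R outer x x"
    by (simp add: f outer_scaleR scaleR_sum_left)
  then show thesis by (rule that)
qed

text \<open>A vector \<open>x\<close> in the kernel with \<open>x \<bullet> x0 \<noteq> 0\<close> splits the space as \<open>span {x}\<close> plus the hyperplane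
  orthogonal to \<open>x0\<close>. The form is unchanged by adding multiples of \<open>x\<close>, so definiteness on the
  hyperplane, which is an open condition, decides everything.\<close>

lemma eventually_psd_with_kernel:
  fixes Q0 :: "real^'i^'i"
  assumes pos: "\<And>y. y \<noteq> 0 \<Longrightarrow> y \<bullet> x0 = 0 \<Longrightarrow> 0 < y \<bullet> (Q0 *v y)"
  shows "\<forall>\<^sub>F Q in nhds Q0. \<forall>x. transpose Q = Q \<longrightarrow> Q *v x = 0 \<longrightarrow> x \<bullet> x0 \<noteq> 0 \<longrightarrow>
    psd Q \<and> (\<forall>y. Q *v y = 0 \<longrightarrow> (\<exists>c. y = c *\<^sub>R x))"
proof -
  define T where "T = sphere 0 1 \<inter> {y. y \<bullet> x0 = 0}"
  have "compact T"
    unfolding T_def by (intro compact_Int_closed compact_sphere closed_Collect_eq continuous_intros)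
  moreover have "continuous_on T (\<lambda>y. y \<bullet> (Q0 *v y))"
    by (intro continuous_intros)
  ultimately obtain c where c: "c > 0" "\<And>y. y \<in> T \<Longrightarrow> c \<le> y \<bullet> (Q0 *v y)"
  proof (cases "T = {}")
    case True
    then show ?thesis using that[of 1] by auto
  next
    case False
    assume "compact T" "continuous_on T (\<lambda>y. y \<bullet> (Q0 *v y))"
    from continuous_attains_inf[OF this(1) False this(2)]
    obtain y where y: "y \<in> T" "\<And>y'. y' \<in> T \<Longrightarrow> y \<bullet> (Q0 *v y) \<le> y' \<bullet> (Q0 *v y')" by auto
    then have "0 < y \<bullet> (Q0 *v y)" by (intro pos) (auto simp: T_def)
    with y that show ?thesis by blast
  qed
  have coercive: "c * (norm y)\<^sup>2 \<le> y \<bullet> (Q0 *v y)" if "y \<bullet> x0 = 0" for y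
  proof (cases "y = 0")
    case False
    then have "y /\<^sub>R norm y \<in> T" using that by (auto simp: T_def)
    then have "c \<le> (y /\<^sub>R norm y) \<bullet> (Q0 *v (y /\<^sub>R norm y))" by (rule c(2))
    then have "c * (norm y)\<^sup>2 \<le> (y /\<^sub>R norm y) \<bullet> (Q0 *v (y /\<^sub>R norm y)) * (norm y)\<^sup>2"
      by (rule mult_right_mono) auto
    also have "\<dots> = y \<bullet> (Q0 *v y)"
      using False by (simp add: matrix_vector_mult_scaleR field_simps power2_eq_square)
    finally show ?thesis .
  qed simp
  obtain K where K: "K > 0" "\<And>(M :: real^'i^'i) x. norm (M *v x) \<le> norm M * norm x * K"
    using bounded_bilinear.pos_bounded[OF bounded_bilinear_matrix_vector] by blast
  have "\<forall>\<^sub>F Q in nhds Q0. norm (Q - Q0) < c / K"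
    using c K by (auto simp: eventually_nhds_metric dist_norm intro!: exI[of _ "c / K"])
  then show ?thesis
  proof eventually_elim
    case (elim Q)
    have def_pos: "0 < y \<bullet> (Q *v y)" if "y \<bullet> x0 = 0" "y \<noteq> 0" for y
    proof -
      have "\<bar>y \<bullet> ((Q - Q0) *v y)\<bar> \<le> norm y * norm ((Q - Q0) *v y)" by (rule Cauchy_Schwarz_ineq2)
      also have "\<dots> \<le> norm y * (norm (Q - Q0) * norm y * K)" by (intro mult_left_mono K) auto
      also have "\<dots> = (norm (Q - Q0) * K) * (norm y)\<^sup>2" by (simp add: power2_eq_square)
      also have "\<dots> < c * (norm y)\<^sup>2"
        using elim K(1) that(2) by (intro mult_strict_right_mono) (auto simp: field_simps)
      finally have "\<bar>y \<bullet> ((Q - Q0) *v y)\<bar> < y \<bullet> (Q0 *v y)" using coercive[OF that(1)] by simp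
      then show ?thesis by (simp add: algebra_simps inner_diff_right)
    qed
    show ?case
    proof (intro allI impI)
      fix x assume sym: "transpose Q = Q" and x: "Q *v x = 0" "x \<bullet> x0 \<noteq> 0"
      have red: "y \<bullet> (Q *v y) = (y - c *\<^sub>R x) \<bullet> (Q *v (y - c *\<^sub>R x))" for y c
        using x(1) symmetric_inner[OF sym, of x y]
        by (simp add: algebra_simps inner_diff_left inner_diff_right)
      have proj: "(y - ((y \<bullet> x0) / (x \<bullet> x0)) *\<^sub>R x) \<bullet> x0 = 0" for y
        using x(2) by (simp add: inner_diff_left)
      have "psd Q"
        unfolding psd_def
      proof (intro conjI allI sym)
        fix y
        let ?w = "y - ((y \<bullet> x0) / (x \<bullet> x0)) *\<^sub>R x"
        have "0 \<le> ?w \<bullet> (Q *v ?w)" using def_pos[OF proj[of y]] by (cases "?w = 0") (auto intro: less_imp_le)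
        then show "0 \<le> y \<bullet> (Q *v y)" by (simp only: red[symmetric])
      qed
      moreover have "\<exists>c. y = c *\<^sub>R x" if "Q *v y = 0" for y
      proof -
        let ?w = "y - ((y \<bullet> x0) / (x \<bullet> x0)) *\<^sub>R x"
        have "?w \<bullet> (Q *v ?w) = 0" using that red[of y] by simp
        then have "?w = 0" using def_pos[OF proj[of y]] by fastforce
        then show ?thesis by (intro exI[of _ "(y \<bullet> x0) / (x \<bullet> x0)"]) simp
      qed
      ultimately show "psd Q \<and> (\<forall>y. Q *v y = 0 \<longrightarrow> (\<exists>c. y = c *\<^sub>R x))" by blast
    qed
  qed
qed

section \<open>Feasible matrices of the relaxation and weak duality\<close>

lemma transpose_diff: "transpose (A - B) = transpose A - transpose B" for A :: "'a::minus^'i^'j"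
  by (simp add: transpose_def vec_eq_iff)

lemma zz_trace: "trace (zz_block X) = (\<Sum>\<alpha>\<in>UNIV. X $ (None, \<alpha>) $ (None, \<alpha>))"
  by (simp add: trace_def zz_block_def)

lemma yy_trace: "trace (yy_block X) = (\<Sum>j\<in>UNIV. \<Sum>\<alpha>\<in>UNIV. X $ (Some j, \<alpha>) $ (Some j, \<alpha>))"
  by (simp add: trace_def yy_block_def sum.cartesian_product case_prod_unfold)

lemma inner_obj_mat: "obj_mat \<gamma> \<bullet> X = trace (yy_block X) - \<gamma> * trace (zz_block X)"
proof -
  have "obj_mat \<gamma> \<bullet> X = (\<Sum>I\<in>UNIV. (case fst I of None \<Rightarrow> -\<gamma> | Some _ \<Rightarrow> 1) * X $ I $ I)"
    by (simp add: inner_vec_def obj_mat_def if_distrib[where f="\<lambda>x. x * _"] cong: if_cong)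
  also have "\<dots> = trace (yy_block X) - \<gamma> * trace (zz_block X)"
    by (simp add: sum_blocks zz_trace yy_trace sum_distrib_left sum_negf)
  finally show ?thesis .
qed

lemma obj_mat_mult_vec: "(obj_mat \<gamma> *v x) $ I = (case fst I of None \<Rightarrow> -\<gamma> | Some _ \<Rightarrow> 1) * x $ I"
  by (simp add: obj_mat_def matrix_vector_mult_def if_distrib[where f="\<lambda>x. x * _"] cong: if_cong)

lemma transpose_obj_mat: "transpose (obj_mat \<gamma>) = obj_mat \<gamma>"
  by (auto simp: transpose_def obj_mat_def vec_eq_iff)

lemma transpose_bSym: "transpose (bSym M) = bSym M"
  by (simp add: bSym_def Let_def transpose_def block_transpose_def vec_eq_iff add_ac)

lemma inner_kron_vec: "kron_vec w z \<bullet> x = (\<Sum>p\<in>UNIV. w $ p * (\<Sum>\<alpha>\<in>UNIV. z $ \<alpha> * x $ (p, \<alpha>)))"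
proof -
  have "kron_vec w z \<bullet> x = (\<Sum>(p, \<alpha>)\<in>UNIV \<times> UNIV. w $ p * (z $ \<alpha> * x $ (p, \<alpha>)))"
    by (simp add: inner_vec_def kron_vec_def mult_ac case_prod_unfold)
  then show ?thesis by (simp add: sum.cartesian_product sum_distrib_left case_prod_unfold)
qed

lemma inner_self_1: "norm z = 1 \<Longrightarrow> (\<Sum>\<alpha>\<in>UNIV. z $ \<alpha> * z $ \<alpha>) = 1" for z :: "real^'m"
  by (metis inner_real_def inner_vec_def norm_eq_1 sum.cong)

text \<open>This identity links the relaxation to the problem: \<open>(1; v) \<otimes> z\<close> is orthogonal to all stacked columns
  exactly when \<open>z\<close> is a left null vector of \<open>S (\<theta> + v)\<close>.\<close>

lemma kron_inner_stacked_col: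
  assumes "affine_map S"
  shows "kron_vec (homog v) z \<bullet> stacked_col S \<theta> i = (z v* S (v + \<theta>)) $ i"
  unfolding affine_map_expansion[OF assms]
  by (simp add: inner_kron_vec sum_option homog_def stacked_col_def vector_matrix_mult_def
      algebra_simps sum.distrib sum_distrib_left sum_distrib_right sum_component)
    (subst sum.swap, simp add: mult_ac)

lemma constraint_inner:
  assumes "X \<in> block_symmetric"
  shows "constraint_mat S \<theta> i j \<bullet>\<^sub>M X = (X *v stacked_col S \<theta> i) $ j"
proof -
  have sym: "transpose X = X" using assms by (simp add: block_symmetric_def)
  then have "constraint_mat S \<theta> i j \<bullet>\<^sub>M X = stacked_col S \<theta> i \<bullet> (X *v axis j 1)"
    by (simp add: mat_inner_symmetric constraint_mat_def inner_bSym[OF assms] inner_outer)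
  also have "\<dots> = (X *v stacked_col S \<theta> i) $ j"
    by (simp add: symmetric_inner[OF sym, of "stacked_col S \<theta> i"] inner_axis')
  finally show ?thesis .
qed

text \<open>For fixed \<open>i\<close> the constraints indexed by \<open>j\<close> are the components of \<open>X s = 0\<close>, where \<open>s\<close> is the
  \<open>i\<close>-th stacked column.\<close>

lemma sdp_feasible_alt:
  "sdp_feasible S \<theta> X \<longleftrightarrow> trace (zz_block X) = 1 \<and> (\<forall>i. X *v stacked_col S \<theta> i = 0) \<and>
     X \<in> block_symmetric \<and> psd X"
  unfolding sdp_feasible_def by (auto simp: constraint_inner vec_eq_iff)

lemma psd_outer: "psd (outer x x)"
  by (simp add: psd_def transpose_outer outer_mult_vec inner_commute)

lemma trace_yy_kron:
  assumes "norm z = 1"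
  shows "trace (yy_block (outer (kron_vec (homog v) z) (kron_vec (homog v) z))) = (norm v)\<^sup>2"
proof -
  have "trace (yy_block (outer (kron_vec (homog v) z) (kron_vec (homog v) z))) =
      (\<Sum>j\<in>UNIV. (v $ j * v $ j) * (\<Sum>\<alpha>\<in>UNIV. z $ \<alpha> * z $ \<alpha>))"
    by (simp add: yy_trace outer_def kron_vec_def homog_def sum_distrib_left mult_ac)
  then show ?thesis
    by (simp add: inner_self_1[OF assms] power2_norm_eq_inner inner_vec_def)
qed

lemma trace_zz_kron:
  assumes "norm z = 1"
  shows "trace (zz_block (outer (kron_vec (homog v) z) (kron_vec (homog v) z))) = 1"
  using inner_self_1[OF assms] by (simp add: zz_trace outer_def kron_vec_def homog_def)

lemma feasible_rank_one:
  assumes S: "affine_map S" and z: "norm z = 1" "z v* S u = 0"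
  shows "sdp_feasible S \<theta> (outer (kron_vec (homog (u - \<theta>)) z) (kron_vec (homog (u - \<theta>)) z))"
proof -
  have "outer (kron_vec w z) (kron_vec w z) \<in> block_symmetric" for w :: "real^('a option)"
    by (simp add: block_symmetric_def transpose_outer)
      (simp add: outer_def block_transpose_def kron_vec_def vec_eq_iff)
  then show ?thesis
    by (simp add: sdp_feasible_alt trace_zz_kron[OF z(1)] psd_outer outer_mult_vec
        kron_inner_stacked_col[OF S] z(2))
qed

text \<open>In the outer product, the trace of the block in row \<open>Some j\<close> and column \<open>None\<close> is \<open>v $ j\<close>.\<close>

lemma kron_homog_determined:
  assumes "norm z = 1" "norm z' = 1"
    and eq: "outer (kron_vec (homog v) z) (kron_vec (homog v) z) =
      outer (kron_vec (homog v') z') (kron_vec (homog v') z')"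
  shows "v = v'"
proof -
  have coord: "(\<Sum>\<alpha>\<in>UNIV. outer (kron_vec (homog v) z) (kron_vec (homog v) z) $ (Some j, \<alpha>) $ (None, \<alpha>)) = v $ j"
    if "norm z = 1" for v z j
  proof -
    have "(\<Sum>\<alpha>\<in>UNIV. outer (kron_vec (homog v) z) (kron_vec (homog v) z) $ (Some j, \<alpha>) $ (None, \<alpha>)) =
        v $ j * (\<Sum>\<alpha>\<in>UNIV. z $ \<alpha> * z $ \<alpha>)"
      by (simp add: outer_def kron_vec_def homog_def sum_distrib_left mult_ac)
    then show ?thesis using inner_self_1[OF that] by simp
  qed
  have "v $ j = v' $ j" for j
    using coord[OF assms(1), of v j] coord[OF assms(2), of v' j] by (simp only: eq)
  then show ?thesis by (simp add: vec_eq_iff)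
qed

lemma weak_duality:
  assumes D: "dual_feasible S \<theta> \<gamma> \<mu> Sig" and X: "sdp_feasible S \<theta> X"
  shows "\<gamma> \<le> trace (yy_block X)"
proof -
  have bs: "X \<in> block_symmetric" and sym: "transpose X = X" and pX: "psd X" and tr: "trace (zz_block X) = 1"
    using X by (auto simp: sdp_feasible_def block_symmetric_def)
  have "constraint_mat S \<theta> i j \<bullet> X = 0" for i j
    using X unfolding sdp_feasible_def mat_inner_symmetric[OF sym] by blast
  moreover have "Sig \<bullet> X = 0"
    using D bs unfolding dual_feasible_def block_symmetric_perp_def mat_inner_symmetric[OF sym, symmetric]
    by blast
  moreover have "0 \<le> (obj_mat \<gamma> - (\<Sum>i\<in>UNIV. \<Sum>j\<in>UNIV. \<mu> i j *\<^sub>R constraint_mat S \<theta> i j) - Sig) \<bullet> X"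
    by (rule psd_inner_nonneg[OF _ pX]) (use D in \<open>simp add: dual_feasible_def\<close>)
  ultimately show ?thesis
    by (simp add: inner_diff_left inner_sum_left inner_obj_mat tr)
qed

section \<open>The dual certificate\<close>

text \<open>Write \<open>b = \<Sum>\<^sub>i l\<^sub>i s\<^sub>i\<close>, and let \<open>b\<^sub>p\<close>, \<open>x\<^sub>p\<close> be the blocks of \<open>b\<close> and \<open>x\<close>, with \<open>0\<close> for the block
  \<open>None\<close>. The quadratic form of this matrix is \<open>x \<mapsto> \<Sum>\<^sub>p (b\<^sub>p \<bullet> x\<^sub>0) (z \<bullet> x\<^sub>p)\<close>. Without
  \<open>block_transpose\<close> it would be \<open>(b \<bullet> x) (z \<bullet> x\<^sub>0)\<close>, a combination of the constraints, which is the same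
  modulo the complement of the block-symmetric matrices; exchanging the two factors is what makes
  \<open>(1; v) \<otimes> z\<close> a null vector of the certificate.\<close>

definition coupling :: "(real^'k::finite \<Rightarrow> real^'n::finite^'m::finite) \<Rightarrow> real^'k \<Rightarrow> real^'m \<Rightarrow> real^'n \<Rightarrow> ('k, 'm) bmat" where
  "coupling S \<theta> z l =
     block_transpose (outer (\<Sum>i\<in>UNIV. l $ i *\<^sub>R stacked_col S \<theta> i) (kron_vec (axis None 1) z))"

text \<open>The Lagrangian of the relaxation: \<open>\<gamma>\<close> is the bound to be certified, \<open>l\<close> the multiplier of the rank
  constraint, and the squares of the constraints are added as a penalty, which makes the form at
  \<open>\<theta>bar\<close> positive definite on the hyperplane orthogonal to \<open>(1; 0) \<otimes> z0\<close>.\<close>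

definition certificate ::
    "(real^'k::finite \<Rightarrow> real^'n::finite^'m::finite) \<Rightarrow> real^'k \<Rightarrow> real \<Rightarrow> real^'m \<Rightarrow> real^'n \<Rightarrow> ('k, 'm) bmat" where
  "certificate S \<theta> \<gamma> z l = obj_mat \<gamma> + (\<Sum>i\<in>UNIV. outer (stacked_col S \<theta> i) (stacked_col S \<theta> i)) +
     (coupling S \<theta> z l + transpose (coupling S \<theta> z l))"

lemma transpose_certificate: "transpose (certificate S \<theta> \<gamma> z l) = certificate S \<theta> \<gamma> z l"
  by (simp add: certificate_def transpose_add transpose_obj_mat transpose_sum transpose_outer add.commute)

lemma inner_coupling:
  assumes "X \<in> block_symmetric"
  shows "coupling S \<theta> z l \<bullet> X = (\<Sum>i\<in>UNIV. l $ i * (stacked_col S \<theta> i \<bullet> (X *v kron_vec (axis None 1) z)))"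
  using assms by (simp add: coupling_def inner_block_transpose block_symmetric_def inner_outer inner_sum_left)

text \<open>The penalty and the coupling vanish on feasible matrices, whose kernel contains all stacked columns.\<close>

lemma inner_certificate:
  assumes "sdp_feasible S \<theta> X"
  shows "certificate S \<theta> \<gamma> z l \<bullet> X = trace (yy_block X) - \<gamma>"
proof -
  have bs: "X \<in> block_symmetric" and sym: "transpose X = X" and tr: "trace (zz_block X) = 1"
    and s: "\<And>i. X *v stacked_col S \<theta> i = 0"
    using assms by (auto simp: sdp_feasible_alt block_symmetric_def)
  have "coupling S \<theta> z l \<bullet> X = 0"
    by (simp add: inner_coupling[OF bs] symmetric_inner[OF sym, of "stacked_col S \<theta> i" for i] s)
  then show ?thesis
    by (simp add: certificate_def inner_add_left inner_transpose sym inner_sum_left inner_outer s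
        inner_obj_mat tr)
qed

text \<open>The dual slack matrix only has to agree with the certificate on block-symmetric matrices, since the
  difference is absorbed by \<open>Sig\<close>.\<close>

lemma certificate_dual_feasible:
  assumes psd: "psd (certificate S \<theta> \<gamma> z l)"
  obtains \<mu> Sig where "dual_feasible S \<theta> \<gamma> \<mu> Sig"
proof -
  let ?xh = "kron_vec (axis None 1) z"
  \<comment> \<open>The first term produces the penalty, the second one twice the coupling, once for each of the
      two transposes.\<close>
  define \<mu> where "\<mu> i j = - (stacked_col S \<theta> i $ j) - 2 * l $ i * ?xh $ j" for i j
  define R where "R = (\<Sum>i\<in>UNIV. \<Sum>j\<in>UNIV. \<mu> i j *\<^sub>R constraint_mat S \<theta> i j)"
  define Sig where "Sig = obj_mat \<gamma> - R - certificate S \<theta> \<gamma> z l"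
  have R_sym: "transpose R = R"
    unfolding R_def transpose_sum transpose_scalar constraint_mat_def transpose_bSym ..
  have "Sig \<bullet>\<^sub>M X = 0" if bs: "X \<in> block_symmetric" for X
  proof -
    have sym: "transpose X = X" using bs by (simp add: block_symmetric_def)
    have row: "(\<Sum>j\<in>UNIV. a $ j * (s \<bullet> (X *v axis j 1))) = s \<bullet> (X *v a)" for a s
    proof -
      have "s \<bullet> (X *v axis j 1) = (X *v s) $ j" for j
        by (simp add: symmetric_inner[OF sym, of s "axis j 1"] inner_axis')
      then have "(\<Sum>j\<in>UNIV. a $ j * (s \<bullet> (X *v axis j 1))) = a \<bullet> (X *v s)"
        by (simp add: inner_vec_def[of a])
      then show ?thesis by (simp add: symmetric_inner[OF sym, of s a])
    qed
    have "R \<bullet> X = (\<Sum>i\<in>UNIV. \<Sum>j\<in>UNIV. \<mu> i j * (stacked_col S \<theta> i \<bullet> (X *v axis j 1)))"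
      unfolding R_def by (simp add: inner_sum_left constraint_mat_def inner_bSym[OF bs] inner_outer)
    also have "\<dots> = (\<Sum>i\<in>UNIV. - (stacked_col S \<theta> i \<bullet> (X *v stacked_col S \<theta> i))
        - 2 * l $ i * (stacked_col S \<theta> i \<bullet> (X *v ?xh)))"
    proof (rule sum.cong[OF refl])
      fix i
      let ?q = "\<lambda>j. stacked_col S \<theta> i \<bullet> (X *v axis j 1)"
      have "(\<Sum>j\<in>UNIV. \<mu> i j * ?q j) =
          - (\<Sum>j\<in>UNIV. stacked_col S \<theta> i $ j * ?q j) - 2 * l $ i * (\<Sum>j\<in>UNIV. ?xh $ j * ?q j)"
        unfolding \<mu>_def left_diff_distrib sum_subtractf sum_distrib_left mult_minus_left sum_negf
        by (simp only: mult.assoc)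
      then show "(\<Sum>j\<in>UNIV. \<mu> i j * ?q j) = - (stacked_col S \<theta> i \<bullet> (X *v stacked_col S \<theta> i))
        - 2 * l $ i * (stacked_col S \<theta> i \<bullet> (X *v ?xh))"
        unfolding row .
    qed
    finally have R: "R \<bullet> X = (\<Sum>i\<in>UNIV. - (stacked_col S \<theta> i \<bullet> (X *v stacked_col S \<theta> i))
        - 2 * l $ i * (stacked_col S \<theta> i \<bullet> (X *v ?xh)))" .
    have "Sig \<bullet> X = 0"
      unfolding Sig_def certificate_def
      by (simp add: inner_diff_left inner_add_left inner_transpose sym R inner_coupling[OF bs]
          inner_sum_left inner_outer sum_subtractf sum_negf sum_distrib_left mult_ac)
    then show ?thesis by (simp add: mat_inner_symmetric[OF sym])
  qed
  moreover have "transpose Sig = Sig"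
    by (simp add: Sig_def transpose_diff R_sym transpose_obj_mat transpose_certificate)
  ultimately have "Sig \<in> block_symmetric_perp" by (simp add: block_symmetric_perp_def)
  moreover have "obj_mat \<gamma> - R - Sig = certificate S \<theta> \<gamma> z l" by (simp add: Sig_def)
  ultimately have "dual_feasible S \<theta> \<gamma> \<mu> Sig"
    using psd by (simp add: dual_feasible_def R_def)
  then show thesis by (rule that)
qed

lemma coupling_nth:
  "coupling S \<theta> z l $ (p, \<alpha>) $ (r, \<beta>) =
     (if r = None then (\<Sum>i\<in>UNIV. l $ i * stacked_col S \<theta> i $ (p, \<beta>)) * z $ \<alpha> else 0)"
  by (simp add: coupling_def block_transpose_def outer_def kron_vec_def axis_def)

lemma stacked_col_None: "(\<Sum>i\<in>UNIV. l $ i * stacked_col S \<theta> i $ (None, \<alpha>)) = (S \<theta> *v l) $ \<alpha>"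
  by (simp add: stacked_col_def coeff_A_def matrix_vector_mult_def mult.commute)

lemma stacked_col_Some: "(\<Sum>i\<in>UNIV. l $ i * stacked_col S \<theta> i $ (Some j, \<alpha>)) = (coeff_B S j *v l) $ \<alpha>"
  by (simp add: stacked_col_def matrix_vector_mult_def mult.commute)

lemma transpose_mult_nth: "(transpose A *v x) $ I = (\<Sum>J\<in>UNIV. A $ J $ I * x $ J)" for A :: "real^'i^'j"
  by (simp add: matrix_vector_mult_def transpose_def del: transpose_matrix_vector)

text \<open>Write \<open>v = u - \<theta>\<close> and \<open>x = (1; v) \<otimes> z\<close>. The stationarity condition \<open>v\<^sub>j = - z \<bullet> B\<^sub>j l\<close> cancels the
  \<open>y\<close>-blocks of the product, and together with \<open>S u l = 0\<close> it gives \<open>z \<bullet> S \<theta> l = \<parallel>v\<parallel>\<^sup>2\<close>, which cancels the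
  leading block. The transposed coupling contributes only \<open>S u l = 0\<close>.\<close>

lemma certificate_kernel:
  assumes S: "affine_map S" and z: "norm z = 1" "z v* S u = 0" and l: "S u *v l = 0"
    and v: "\<And>j. (u - \<theta>) $ j = - (z \<bullet> (coeff_B S j *v l))"
  shows "certificate S \<theta> ((norm (u - \<theta>))\<^sup>2) z l *v kron_vec (homog (u - \<theta>)) z = 0"
proof -
  define v where "v = u - \<theta>"
  define x where "x = kron_vec (homog v) z"
  have zz: "(\<Sum>\<beta>\<in>UNIV. z $ \<beta> * z $ \<beta>) = 1" by (rule inner_self_1[OF z(1)])
  have s0: "stacked_col S \<theta> i \<bullet> x = 0" for i
    using kron_inner_stacked_col[OF S, of v z \<theta> i] z(2) by (simp add: x_def v_def inner_commute)
  have Su: "S u *v l = S \<theta> *v l + (\<Sum>j\<in>UNIV. v $ j *\<^sub>R (coeff_B S j *v l))"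
  proof -
    have "S u = S \<theta> + (\<Sum>j\<in>UNIV. v $ j *\<^sub>R coeff_B S j)"
      using affine_map_expansion[OF S, of v \<theta>] by (simp add: v_def coeff_A_def)
    moreover have "(\<Sum>j\<in>UNIV. v $ j *\<^sub>R coeff_B S j) *v l = (\<Sum>j\<in>UNIV. v $ j *\<^sub>R (coeff_B S j *v l))"
      by (simp add: bounded_bilinear.sum_left[OF bounded_bilinear_matrix_vector] scaleR_matrix_vector_assoc)
    ultimately show ?thesis by (simp add: algebra_simps)
  qed
  have zA: "z \<bullet> (S \<theta> *v l) = (norm v)\<^sup>2"
  proof -
    have "0 = z \<bullet> (S u *v l)" using l by simp
    also have "\<dots> = z \<bullet> (S \<theta> *v l) + (\<Sum>j\<in>UNIV. v $ j * (z \<bullet> (coeff_B S j *v l)))"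
      by (simp add: Su inner_add_right inner_sum_right)
    also have "(\<Sum>j\<in>UNIV. v $ j * (z \<bullet> (coeff_B S j *v l))) = - (norm v)\<^sup>2"
    proof -
      have "v $ j * (z \<bullet> (coeff_B S j *v l)) = - (v $ j * v $ j)" for j
        using v[of j] by (simp add: v_def)
      then show ?thesis by (simp add: sum_negf power2_norm_eq_inner inner_vec_def[of v])
    qed
    finally show ?thesis by simp
  qed
  have xN: "x $ (None, \<alpha>) = z $ \<alpha>" and xS: "x $ (Some j, \<alpha>) = v $ j * z $ \<alpha>" for j \<alpha>
    by (simp_all add: x_def kron_vec_def homog_def)
  have C1: "(coupling S \<theta> z l *v x) $ (p, \<alpha>) =
      z $ \<alpha> * (\<Sum>\<beta>\<in>UNIV. (\<Sum>i\<in>UNIV. l $ i * stacked_col S \<theta> i $ (p, \<beta>)) * z $ \<beta>)" for p \<alpha>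
    by (simp add: matrix_vector_mult_def sum_blocks coupling_nth xN sum_distrib_left mult_ac)
  have C1N: "(coupling S \<theta> z l *v x) $ (None, \<alpha>) = (norm v)\<^sup>2 * z $ \<alpha>" for \<alpha>
    unfolding C1 stacked_col_None zA[symmetric] by (simp add: inner_vec_def mult.commute)
  have C1S: "(coupling S \<theta> z l *v x) $ (Some j, \<alpha>) = - (v $ j * z $ \<alpha>)" for j \<alpha>
    unfolding C1 stacked_col_Some using v[of j] by (simp add: v_def inner_vec_def mult.commute)
  have C2S: "(transpose (coupling S \<theta> z l) *v x) $ (Some j, \<alpha>) = 0" for j \<alpha>
    unfolding transpose_mult_nth by (simp add: sum_blocks coupling_nth)
  have C2N: "(transpose (coupling S \<theta> z l) *v x) $ (None, \<alpha>) = 0" for \<alpha>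
  proof -
    have "(transpose (coupling S \<theta> z l) *v x) $ (None, \<alpha>) =
        (S \<theta> *v l) $ \<alpha> * (\<Sum>\<beta>\<in>UNIV. z $ \<beta> * z $ \<beta>) +
        (\<Sum>j\<in>UNIV. v $ j * (coeff_B S j *v l) $ \<alpha> * (\<Sum>\<beta>\<in>UNIV. z $ \<beta> * z $ \<beta>))"
      unfolding transpose_mult_nth
      by (simp add: sum_blocks coupling_nth xN xS stacked_col_None stacked_col_Some sum_distrib_left mult_ac)
    also have "\<dots> = (S u *v l) $ \<alpha>" by (simp add: zz Su)
    finally show ?thesis using l by simp
  qed
  have "(certificate S \<theta> ((norm v)\<^sup>2) z l *v x) $ I = 0" for I
  proof -
    have "(certificate S \<theta> ((norm v)\<^sup>2) z l *v x) $ I = (obj_mat ((norm v)\<^sup>2) *v x) $ I +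
        (coupling S \<theta> z l *v x) $ I + (transpose (coupling S \<theta> z l) *v x) $ I"
      by (simp add: certificate_def matrix_vector_mult_add_rdistrib outer_mult_vec s0
          bounded_bilinear.sum_left[OF bounded_bilinear_matrix_vector] del: transpose_matrix_vector)
    also have "\<dots> = 0"
      by (cases I; cases "fst I")
        (auto simp: obj_mat_mult_vec C1N C1S C2N C2S xN xS simp del: transpose_matrix_vector)
    finally show ?thesis .
  qed
  then show ?thesis by (simp add: vec_eq_iff x_def v_def)
qed

text \<open>The form is the sum of the squares of the trailing components of \<open>y\<close> and of \<open>s\<^sub>i \<bullet> y\<close>. Where it
  vanishes, only the leading block of \<open>y\<close> remains; this block is a left null vector of \<open>S p\<close>, hence a
  multiple of \<open>z0\<close>, and orthogonality to \<open>z0\<close> makes it \<open>0\<close>.\<close>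

lemma certificate_base_definite:
  fixes S :: "real^'k::finite \<Rightarrow> real^'n::finite^'m::finite"
  assumes rk: "rank (S p) = CARD('m) - 1" and z0: "norm z0 = 1" "z0 v* S p = 0"
    and y: "y \<noteq> 0" "y \<bullet> kron_vec (axis None 1) z0 = 0"
  shows "0 < y \<bullet> (certificate S p 0 z0 0 *v y)"
proof -
  define q where "q = (\<Sum>j\<in>UNIV. \<Sum>\<alpha>\<in>UNIV. (y $ (Some j, \<alpha>))\<^sup>2)"
  define r where "r = (\<Sum>i\<in>UNIV. (stacked_col S p i \<bullet> y)\<^sup>2)"
  have "coupling S p z0 0 = 0" by (simp add: vec_eq_iff coupling_nth split_paired_all)
  then have "y \<bullet> (certificate S p 0 z0 0 *v y) = y \<bullet> (obj_mat 0 *v y) + r"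
    by (simp add: certificate_def matrix_vector_mult_add_rdistrib outer_mult_vec inner_add_right r_def
        bounded_bilinear.sum_left[OF bounded_bilinear_matrix_vector] inner_sum_right power2_eq_square
        inner_commute transpose_def zero_vec_def[symmetric])
  also have "y \<bullet> (obj_mat 0 *v y) = q"
    by (simp add: inner_vec_def[of y] obj_mat_mult_vec sum_blocks q_def power2_eq_square)
  finally have form: "y \<bullet> (certificate S p 0 z0 0 *v y) = q + r" .
  have nn: "q \<ge> 0" "r \<ge> 0" by (auto simp: q_def r_def intro!: sum_nonneg)
  have "q + r \<noteq> 0"
  proof
    assume "q + r = 0"
    then have "q = 0" "r = 0" using nn by linarith+
    have yS: "y $ (Some j, \<alpha>) = 0" for j \<alpha>
      using \<open>q = 0\<close> unfolding q_def by (simp add: sum_nonneg_eq_0_iff sum_nonneg)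
    have s0: "stacked_col S p i \<bullet> y = 0" for i
      using \<open>r = 0\<close> unfolding r_def by (simp add: sum_nonneg_eq_0_iff)
    define \<zeta> where "\<zeta> = (\<chi> \<alpha>. y $ (None, \<alpha>))"
    have "\<zeta> v* S p = 0"
    proof -
      have "(\<zeta> v* S p) $ i = 0" for i
        using s0[of i]
        by (simp add: inner_vec_def sum_blocks yS stacked_col_def coeff_A_def vector_matrix_mult_def
            \<zeta>_def mult.commute)
      then show ?thesis by (simp add: vec_eq_iff)
    qed
    then obtain a where a: "\<zeta> = a *\<^sub>R z0"
      using left_null_collinear[OF rk z0(2)] z0(1) by (metis norm_zero zero_neq_one)
    have "0 = \<zeta> \<bullet> z0"
      using y(2) by (simp add: inner_vec_def sum_blocks yS kron_vec_def axis_def \<zeta>_def)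
    also have "\<dots> = a" using z0(1) by (simp add: a power2_norm_eq_inner[symmetric])
    finally have "\<zeta> = 0" using a by simp
    then have "y $ (None, \<alpha>) = 0" for \<alpha> by (simp add: \<zeta>_def vec_eq_iff)
    then have "y $ I = 0" for I using yS by (cases I; cases "fst I") auto
    then show False using y(1) by (simp add: vec_eq_iff)
  qed
  then show ?thesis using form nn by simp
qed

lemma certificate_tendsto:
  fixes S :: "real^'k::finite \<Rightarrow> real^'n::finite^'m::finite"
  assumes S: "affine_map S" and lim: "(\<theta> \<longlongrightarrow> \<theta>0) F" "(\<gamma> \<longlongrightarrow> \<gamma>0) F" "(z \<longlongrightarrow> z0) F" "(l \<longlongrightarrow> l0) F"
  shows "((\<lambda>t. certificate S (\<theta> t) (\<gamma> t) (z t) (l t)) \<longlongrightarrow> certificate S \<theta>0 \<gamma>0 z0 l0) F"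
proof -
  obtain L c where L: "linear L" "\<And>x. S x = L x + c" using S unfolding affine_map_def by blast
  have "((\<lambda>t. S (\<theta> t)) \<longlongrightarrow> S \<theta>0) F"
    unfolding L(2) using L(1) lim(1)
    by (intro tendsto_intros) (simp_all add: bounded_linear.tendsto linear_conv_bounded_linear)
  then have col: "((\<lambda>t. stacked_col S (\<theta> t) i $ (p, \<alpha>)) \<longlongrightarrow> stacked_col S \<theta>0 i $ (p, \<alpha>)) F" for i p \<alpha>
    by (cases p) (auto simp: stacked_col_def coeff_A_def intro!: tendsto_intros)
  have arrow: "((\<lambda>t. coupling S (\<theta> t) (z t) (l t) $ I $ J) \<longlongrightarrow> coupling S \<theta>0 z0 l0 $ I $ J) F" for I J
    by (cases I; cases J) (auto simp: coupling_nth intro!: tendsto_intros col lim)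
  have obj: "((\<lambda>t. obj_mat (\<gamma> t) $ I $ J) \<longlongrightarrow> obj_mat \<gamma>0 $ I $ J) F" for I J :: "'k option \<times> 'm"
    by (cases "fst J") (auto simp: obj_mat_def intro!: tendsto_intros lim)
  have sq: "((\<lambda>t. outer (stacked_col S (\<theta> t) i) (stacked_col S (\<theta> t) i) $ I $ J) \<longlongrightarrow>
      outer (stacked_col S \<theta>0 i) (stacked_col S \<theta>0 i) $ I $ J) F" for i I J
    using tendsto_mult[OF col col] by (cases I; cases J) (simp add: outer_def)
  show ?thesis
    unfolding certificate_def
    by (intro vec_tendstoI) (simp add: transpose_def, intro tendsto_intros obj arrow sq)
qed

section \<open>Exactness from a certificate\<close>

lemma rank_outer:
  fixes x :: "real^'i"
  assumes "x \<noteq> 0"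
  shows "rank (outer x x) = 1"
proof -
  have "range ((*v) (outer x x)) = span {x}"
    unfolding span_singleton outer_mult_vec
  proof (intro set_eqI iffI)
    fix w assume "w \<in> range (\<lambda>k. k *\<^sub>R x)"
    then obtain k where "w = k *\<^sub>R x" by auto
    then have "w = (x \<bullet> ((k / (x \<bullet> x)) *\<^sub>R x)) *\<^sub>R x" using assms by simp
    then show "w \<in> range (\<lambda>w. (x \<bullet> w) *\<^sub>R x)" by blast
  qed auto
  then show ?thesis using assms by (simp add: rank_dim_range dim_singleton)
qed

text \<open>Lower semicontinuity of the rank makes the deficient set closed.\<close>

lemma nearest_point_nonempty:
  assumes S: "affine_map S" and ne: "deficient_params S \<noteq> {}"
  obtains u where "nearest_point S \<theta> u"
proof -
  obtain L c where L: "linear L" "\<And>x. S x = L x + c" using S unfolding affine_map_def by blast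
  have "isCont S u" for u
    unfolding L(2) using L(1) by (intro continuous_intros) (simp_all add: linear_continuous_at linear_conv_bounded_linear)
  then have cS: "filterlim S (nhds (S u)) (nhds u)" for u by (simp add: continuous_at tendsto_nhds_iff)
  have "open (- deficient_params S)"
    unfolding open_subopen[of "- deficient_params S"]
  proof
    fix u assume "u \<in> - deficient_params S"
    then have "\<forall>\<^sub>F x in nhds u. x \<in> - deficient_params S"
      using eventually_compose_filterlim[OF eventually_rank_ge cS[of u]]
      by (auto simp: deficient_params_def elim!: eventually_mono)
    then show "\<exists>T. open T \<and> u \<in> T \<and> T \<subseteq> - deficient_params S" unfolding eventually_nhds by blast
  qed
  then have "closed (deficient_params S)" by (simp add: open_closed)
  from distance_attains_inf[OF this ne, of \<theta>] obtain u where
    u: "u \<in> deficient_params S" "\<And>y. y \<in> deficient_params S \<Longrightarrow> dist \<theta> u \<le> dist \<theta> y" by blast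
  have "nearest_point S \<theta> u"
    unfolding nearest_point_def is_arg_min_def
    using u by (auto simp: not_less dist_norm norm_minus_commute intro!: power_mono)
  then show thesis by (rule that)
qed

text \<open>The certificate is complementary to every optimal \<open>X\<close> and has a one-dimensional kernel, so the optimal \<open>X\<close> is the rank-one matrix built from that kernel.\<close>

lemma exact_if_certificate:
  fixes S :: "real^'k::finite \<Rightarrow> real^'n::finite^'m::finite"
  assumes S: "affine_map S" and near: "nearest_point S \<theta> u"
    and z: "norm z = 1" "z v* S u = 0"
    and psd: "psd (certificate S \<theta> ((norm (u - \<theta>))\<^sup>2) z l)"
    and ker: "\<And>y. certificate S \<theta> ((norm (u - \<theta>))\<^sup>2) z l *v y = 0 \<Longrightarrow>
      \<exists>c. y = c *\<^sub>R kron_vec (homog (u - \<theta>)) z"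
  shows "relaxation_exact S \<theta> \<and>
    {u'. recovered_point S \<theta> u'} = {u} \<and> {u'. nearest_point S \<theta> u'} = {u}"
proof -
  define x where "x = kron_vec (homog (u - \<theta>)) z"
  define \<gamma> where "\<gamma> = (norm (u - \<theta>))\<^sup>2"
  define X where "X = outer x x"
  have fX: "sdp_feasible S \<theta> X" unfolding X_def x_def by (rule feasible_rank_one[OF S z])
  have vX: "trace (yy_block X) = \<gamma>" unfolding X_def x_def \<gamma>_def by (rule trace_yy_kron[OF z(1)])
  obtain \<mu> Sig where dual: "dual_feasible S \<theta> \<gamma> \<mu> Sig"
    using certificate_dual_feasible[OF psd] unfolding \<gamma>_def .
  have lower: "\<gamma> \<le> trace (yy_block Y)" if "sdp_feasible S \<theta> Y" for Y
    by (rule weak_duality[OF dual that])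
  have unique: "Y = X" if Y: "sdp_feasible S \<theta> Y" "trace (yy_block Y) = \<gamma>" for Y
  proof -
    have "psd Y" using Y by (simp add: sdp_feasible_def)
    moreover have "certificate S \<theta> ((norm (u - \<theta>))\<^sup>2) z l \<bullet> Y = 0"
      using inner_certificate[OF Y(1)] Y(2) by (simp add: \<gamma>_def)
    ultimately obtain s where s: "Y = s *\<^sub>R X"
      using psd_complementary_rank_one[OF psd _ _ ker] unfolding X_def x_def by metis
    have "trace (zz_block Y) = s * trace (zz_block X)" by (simp add: s zz_trace sum_distrib_left)
    then have "s = 1" using Y(1) fX by (simp add: sdp_feasible_def)
    then show ?thesis using s by simp
  qed
  have min_iff: "sdp_minimizer S \<theta> Y \<longleftrightarrow> Y = X" for Y
    unfolding sdp_minimizer_def is_arg_min_def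
    using fX vX lower unique by (metis not_less order_antisym_conv)
  have u: "u \<in> deficient_params S" and umin: "\<And>u'. u' \<in> deficient_params S \<Longrightarrow> \<gamma> \<le> (norm (u' - \<theta>))\<^sup>2"
    using near unfolding nearest_point_def is_arg_min_def \<gamma>_def by (auto simp: not_less)
  have v1: "nearest_val S \<theta> = ereal \<gamma>"
    unfolding nearest_val_def
    by (intro antisym INF_greatest INF_lower2[OF u]) (auto simp: umin, simp add: \<gamma>_def)
  have v2: "sdp_val S \<theta> = ereal \<gamma>"
    unfolding sdp_val_def
    by (intro antisym INF_greatest INF_lower2[of X]) (auto simp: lower fX vX)
  have v3: "dual_val S \<theta> = ereal \<gamma>"
    unfolding dual_val_def
    by (intro antisym SUP_least SUP_upper2[of \<gamma>]) (use dual weak_duality[OF _ fX] vX in auto)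
  have "norm x \<noteq> 0"
  proof
    assume "norm x = 0"
    then have "trace (zz_block X) = 0" by (simp add: X_def zz_trace outer_def)
    then show False using fX by (simp add: sdp_feasible_def)
  qed
  then have "rank X = 1" unfolding X_def by (intro rank_outer) auto
  then have exact: "relaxation_exact S \<theta>"
    unfolding relaxation_exact_def using v1 v2 v3 min_iff by (intro conjI exI[of _ X]) auto
  have rec: "recovered_point S \<theta> u' \<longleftrightarrow> u' = u" for u'
  proof
    assume "recovered_point S \<theta> u'"
    then obtain v z' where "norm z' = 1" "u' = \<theta> + v"
      "X = outer (kron_vec (homog v) z') (kron_vec (homog v) z')"
      unfolding recovered_point_def min_iff by auto
    moreover from this have "u - \<theta> = v"
      unfolding X_def x_def by (intro kron_homog_determined[OF z(1)]) auto
    ultimately show "u' = u" by auto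
  next
    assume "u' = u"
    then show "recovered_point S \<theta> u'"
      unfolding recovered_point_def min_iff X_def x_def
      using z(1) by (intro exI[of _ "u - \<theta>"] exI[of _ z] exI[of _ "outer x x"]) (auto simp: x_def)
  qed
  have "nearest_point S \<theta> u' \<longleftrightarrow> u' = u" for u'
  proof
    assume n: "nearest_point S \<theta> u'"
    then have u': "u' \<in> deficient_params S" "(norm (u' - \<theta>))\<^sup>2 = \<gamma>"
      using u umin unfolding nearest_point_def is_arg_min_def \<gamma>_def
      by (auto simp: not_less intro: antisym)
    then obtain z' where z': "norm z' = 1" "z' v* S u' = 0"
      unfolding deficient_params_def mem_Collect_eq deficient_iff_left_null by blast
    have "outer (kron_vec (homog (u' - \<theta>)) z') (kron_vec (homog (u' - \<theta>)) z') = X"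
      by (rule unique[OF feasible_rank_one[OF S z']]) (simp add: trace_yy_kron[OF z'(1)] u')
    then have "u' - \<theta> = u - \<theta>"
      unfolding X_def x_def by (intro kron_homog_determined[OF z'(1) z(1)])
    then show "u' = u" by simp
  qed (use near in simp)
  with exact rec show ?thesis by auto
qed

section \<open>Local exactness\<close>

theorem theorem1p1:
  fixes S :: "real^'k::finite \<Rightarrow> real^'n::finite^'m::finite"
    and \<theta>bar :: "real^'k"
  assumes "CARD('m) \<le> CARD('n)"
    and "affine_map S"
    and "\<theta>bar \<in> deficient_params S"
    and "meet_nontangentially {A :: real^'n^'m. rank A = CARD('m) - 1} (range S) (S \<theta>bar)"
  shows "\<exists>\<epsilon>>0. \<forall>\<theta>. norm (\<theta> - \<theta>bar) < \<epsilon> \<longrightarrow>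
           relaxation_exact S \<theta> \<and>
           (\<exists>u. {u'. recovered_point S \<theta> u'} = {u} \<and> {u'. nearest_point S \<theta> u'} = {u})"
proof -
  obtain L c0 where L: "linear L" and S: "\<And>x. S x = L x + c0"
    using assms(2) unfolding affine_map_def by blast
  have B: "coeff_B S j = L (axis j 1)" for j by (simp add: coeff_B_def S linear_0[OF L])
  have rk: "rank (S \<theta>bar) = CARD('m) - 1"
    using assms(4) unfolding meet_nontangentially_def by auto
  obtain z0 where z0: "norm z0 = 1" "z0 v* S \<theta>bar = 0"
    using assms(3) unfolding deficient_params_def mem_Collect_eq deficient_iff_left_null by blast
  obtain C where C: "\<And>\<epsilon>. \<epsilon> > 0 \<Longrightarrow> \<forall>\<^sub>F u in nhds \<theta>bar. u \<in> deficient_params S \<longrightarrow>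
    (\<forall>\<theta>. nearest_point S \<theta> u \<longrightarrow>
      (\<exists>z l. norm z = 1 \<and> norm (z - z0) < \<epsilon> \<and> z v* S u = 0 \<and> S u *v l = 0 \<and>
        u - \<theta> = normal_vector L z l \<and> norm l \<le> C * norm (u - \<theta>)))"
    using residual_is_normal[OF L S assms(4) z0(2,1)] by blast
  define x0 :: "('k, 'm) bvec" where "x0 = kron_vec (axis None 1) z0"
  let ?good = "\<lambda>Q :: ('k, 'm) bmat. \<forall>x. transpose Q = Q \<longrightarrow> Q *v x = 0 \<longrightarrow> x \<bullet> x0 \<noteq> 0 \<longrightarrow>
    psd Q \<and> (\<forall>y. Q *v y = 0 \<longrightarrow> (\<exists>c. y = c *\<^sub>R x))"
  let ?cert = "\<lambda>(\<theta>, \<gamma>, z, l). certificate S \<theta> \<gamma> z l"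
  have "\<forall>\<^sub>F Q in nhds (certificate S \<theta>bar 0 z0 0). ?good Q"
    by (rule eventually_psd_with_kernel) (auto simp: x0_def intro: certificate_base_definite rk z0)
  moreover have "(?cert \<longlongrightarrow> certificate S \<theta>bar 0 z0 0) (nhds (\<theta>bar, 0, z0, 0))"
    unfolding case_prod_unfold
    by (rule certificate_tendsto[OF assms(2)]) (auto intro!: tendsto_eq_intros filterlim_ident)
  ultimately have "\<forall>\<^sub>F t in nhds (\<theta>bar, 0, z0, 0). ?good (?cert t)"
    by (rule eventually_compose_filterlim)
  then obtain \<eta> where \<eta>: "\<eta> > 0" "\<And>t. dist t (\<theta>bar, 0, z0, 0) < \<eta> \<Longrightarrow> ?good (?cert t)"
    unfolding eventually_nhds_metric by blast
  \<comment> \<open>A quarter for each of the four arguments; the bound \<open>1\<close> keeps \<open>z\<close> off the hyperplane orthogonal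
      to \<open>z0\<close> and bounds the squared residual by the residual.\<close>
  define \<eta>1 where "\<eta>1 = min (\<eta> / 4) 1"
  have \<eta>1: "\<eta>1 > 0" using \<eta>(1) by (simp add: \<eta>1_def)
  have good: "?good (certificate S \<theta> \<gamma> z l)"
    if "norm (\<theta> - \<theta>bar) < \<eta>1" "\<bar>\<gamma>\<bar> < \<eta>1" "norm (z - z0) < \<eta>1" "norm l < \<eta>1" for \<theta> \<gamma> z l
  proof -
    have tri: "dist (a, b) (a', b') \<le> dist a a' + dist b b'"
      for a a' :: "'u::metric_space" and b b' :: "'v::metric_space"
      unfolding dist_Pair_Pair by (rule sqrt_sum_squares_le_sum) auto
    have "dist (\<theta>, \<gamma>, z, l) (\<theta>bar, 0, z0, 0) \<le>
        dist \<theta> \<theta>bar + (dist \<gamma> 0 + (dist z z0 + dist l 0))"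
      by (intro order_trans[OF tri] add_mono order_refl)
    also have "\<dots> < \<eta>" using that by (simp add: dist_norm \<eta>1_def)
    finally show ?thesis using \<eta>(2)[of "(\<theta>, \<gamma>, z, l)"] by simp
  qed
  obtain \<rho> where \<rho>: "\<rho> > 0" "\<And>u \<theta>. norm (u - \<theta>bar) < \<rho> \<Longrightarrow> u \<in> deficient_params S \<Longrightarrow>
    nearest_point S \<theta> u \<Longrightarrow> \<exists>z l. norm z = 1 \<and> norm (z - z0) < \<eta>1 \<and> z v* S u = 0 \<and> S u *v l = 0 \<and>
        u - \<theta> = normal_vector L z l \<and> norm l \<le> C * norm (u - \<theta>)"
    using C[OF \<eta>1] unfolding eventually_nhds_metric dist_norm by blast
  define \<epsilon> where "\<epsilon> = min \<eta>1 (min (\<rho> / 2) (\<eta>1 / (\<bar>C\<bar> + 1)))"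
  have \<epsilon>: "\<epsilon> > 0" "\<epsilon> \<le> \<eta>1" "\<epsilon> \<le> \<rho> / 2" "\<bar>C\<bar> * \<epsilon> \<le> \<eta>1"
  proof -
    show "\<epsilon> > 0" using \<eta>1 \<rho>(1) by (simp add: \<epsilon>_def)
    show "\<epsilon> \<le> \<eta>1" "\<epsilon> \<le> \<rho> / 2"
      unfolding \<epsilon>_def by (rule min.cobounded1, rule min.coboundedI2[OF min.cobounded1])
    have "(\<bar>C\<bar> + 1) * \<epsilon> \<le> (\<bar>C\<bar> + 1) * (\<eta>1 / (\<bar>C\<bar> + 1))" by (intro mult_left_mono) (auto simp: \<epsilon>_def)
    also have "\<dots> = \<eta>1" by simp
    finally show "\<bar>C\<bar> * \<epsilon> \<le> \<eta>1" using \<open>\<epsilon> > 0\<close> by (simp add: algebra_simps)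
  qed
  show ?thesis
  proof (intro exI[of _ \<epsilon>] conjI \<epsilon>(1) allI impI)
    fix \<theta> assume \<theta>: "norm (\<theta> - \<theta>bar) < \<epsilon>"
    obtain u where near: "nearest_point S \<theta> u"
      using nearest_point_nonempty[OF assms(2)] assms(3) by blast
    have u: "u \<in> deficient_params S" using near by (simp add: nearest_point_def is_arg_min_def)
    have "(norm (u - \<theta>))\<^sup>2 \<le> (norm (\<theta>bar - \<theta>))\<^sup>2"
      using near assms(3) unfolding nearest_point_def is_arg_min_def by (auto simp: not_less)
    then have "norm (u - \<theta>) \<le> norm (\<theta>bar - \<theta>)" by (rule power2_le_imp_le) simp
    then have v: "norm (u - \<theta>) < \<epsilon>" using \<theta> by (simp add: norm_minus_commute)
    have "norm (u - \<theta>bar) < \<rho>"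
      using norm_triangle_ineq[of "u - \<theta>" "\<theta> - \<theta>bar"] v \<theta> \<epsilon>(3) by simp
    from \<rho>(2)[OF this u near] obtain z l where z: "norm z = 1" "norm (z - z0) < \<eta>1" "z v* S u = 0"
      and l: "S u *v l = 0" "u - \<theta> = normal_vector L z l" "norm l \<le> C * norm (u - \<theta>)" by blast
    \<comment> \<open>The residual is \<open>v\<^sub>j = z \<bullet> B\<^sub>j l\<close>, so \<open>- l\<close> is the multiplier in the sign convention of the
        certificate.\<close>
    define \<gamma> where "\<gamma> = (norm (u - \<theta>))\<^sup>2"
    define x where "x = kron_vec (homog (u - \<theta>)) z"
    have neg: "A *v (- l) = - (A *v l)" for A :: "real^'n^'m"
      by (rule linear_neg[OF matrix_vector_mul_linear])
    have kernel: "certificate S \<theta> \<gamma> z (- l) *v x = 0"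
      unfolding \<gamma>_def x_def
    proof (rule certificate_kernel[OF assms(2) z(1,3)])
      show "S u *v - l = 0" using l(1) by (simp add: neg)
      show "(u - \<theta>) $ j = - (z \<bullet> (coeff_B S j *v - l))" for j
        unfolding l(2) by (simp add: normal_vector_def B neg)
    qed
    have "x \<bullet> x0 = z \<bullet> z0"
      by (simp add: x_def inner_kron_vec sum_option homog_def x0_def)
        (simp add: kron_vec_def axis_def inner_vec_def)
    moreover have "z \<bullet> z0 \<noteq> 0"
    proof
      assume "z \<bullet> z0 = 0"
      moreover have "z \<bullet> z = 1" "z0 \<bullet> z0 = 1" using z(1) z0(1) by (simp_all add: norm_eq_1)
      ultimately have "(norm (z - z0))\<^sup>2 = 2"
        by (simp add: power2_norm_eq_inner inner_diff_left inner_diff_right inner_commute)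
      moreover have "norm (z - z0) < 1" using z(2) by (simp add: \<eta>1_def)
      ultimately show False using power_less_one_iff[of "norm (z - z0)" 2] by simp
    qed
    ultimately have "x \<bullet> x0 \<noteq> 0" by simp
    moreover have "?good (certificate S \<theta> \<gamma> z (- l))"
    proof (rule good)
      show "norm (\<theta> - \<theta>bar) < \<eta>1" using \<theta> \<epsilon>(2) by simp
      have "norm (u - \<theta>) < 1" using v \<epsilon>(2) by (simp add: \<eta>1_def)
      then have "norm (u - \<theta>) * norm (u - \<theta>) \<le> norm (u - \<theta>) * 1" by (intro mult_left_mono) auto
      then show "\<bar>\<gamma>\<bar> < \<eta>1" using v \<epsilon>(2) by (simp add: \<gamma>_def power2_eq_square)
      have l_le: "norm l \<le> \<bar>C\<bar> * norm (u - \<theta>)" using l(3) by (rule order_trans) (simp add: mult_right_mono)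
      then show "norm (- l) < \<eta>1"
      proof (cases "C = 0")
        case False
        then have "\<bar>C\<bar> * norm (u - \<theta>) < \<bar>C\<bar> * \<epsilon>" using v by simp
        then show ?thesis using l_le \<epsilon>(4) by simp
      qed (use l_le \<eta>1 in simp)
    qed (rule z(2))
    ultimately have "psd (certificate S \<theta> \<gamma> z (- l))"
      "\<And>y. certificate S \<theta> \<gamma> z (- l) *v y = 0 \<Longrightarrow> \<exists>c. y = c *\<^sub>R x"
      using kernel transpose_certificate by blast+
    from exact_if_certificate[OF assms(2) near z(1,3) this[unfolded \<gamma>_def x_def]]
    show "relaxation_exact S \<theta>" "\<exists>u. {u'. recovered_point S \<theta> u'} = {u} \<and> {u'. nearest_point S \<theta> u'} = {u}"
      by blast+
  qed
qed

end
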